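(* Let $n\geq 15$ with $n\equiv 3\pmod 4$ and $r=5$. Let $V=\{x_1,\dots,x_{n-10}\}\sqcup\{a,b,c,d,e,f,g,h,k,m\}$ and consider the labelled graph on $V$ with edges: for $1\leq s\leq n-11$, $\{x_s,x_{s+1}\}$ with label $1$ if $s$ is odd and label $0$ if $s$ is even; $\{x_{n-10},a\}$ with label $1$; $\{a,b\}$ with label $2$; $\{b,c\}$ with label $3$; $\{c,d\}$ with label $4$; $\{e,f\}$ with label $4$; $\{f,g\}$ with label $3$; $\{c,e\}$ and $\{d,f\}$ with label $2$; $\{h,k\}$ with label $4$; $\{k,m\}$ with label $3$; $\{h,e\}$ with the two labels $1$ and $3$; $\{k,f\}$ with label $1$; and $\{m,g\}$ with the three labels $1,2,4$. Then $G\cong A_n$ and $(G,(\rho_0,\dots,\rho_4))$ is a string C-group of rank 5 with Schläfli type $\{n-9,6,5,3\}$.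
   Context: A string group generated by involutions (sggi) of rank $r$ is a pair $(G,(\rho_0,\dots,\rho_{r-1}))$ where $\rho_0,\dots,\rho_{r-1}$ are involutions generating the group $G$ such that $(\rho_i\rho_j)^2=1$ whenever $|i-j|\geq 2$. It is a string C-group if in addition it satisfies the intersection property: for all $J,K\subseteq\{0,\dots,r-1\}$, $\langle \rho_j : j\in J\rangle\cap\langle\rho_k : k\in K\rangle=\langle \rho_j : j\in J\cap K\rangle$. The Schläfli type is $\{p_1,\dots,p_{r-1}\}$ where $p_i$ is the order of $\rho_{i-1}\rho_i$. Labelled-graph convention: the vertex set $V$ is finite, and each edge $\{a,b\}$ ($a\neq b$) carries one or more labels from $\{0,\dots,r-1\}$, the edges carrying any given label being pairwise disjoint; $\rho_k$ denotes the permutation of $V$ equal to the product of the transpositions $(a\,b)$ over all edges $\{a,b\}$ carrying label $k$, and $G=\langle\rho_0,\dots,\rho_{r-1}\rangle\leq \mathrm{Sym}(V)$. *)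

theory Defs
  imports "HOL-Algebra.Sym_Groups" "HOL-Algebra.Multiplicative_Group"
begin

definition sggi :: "('a, 'b) monoid_scheme \<Rightarrow> (nat \<Rightarrow> 'a) \<Rightarrow> nat \<Rightarrow> bool" where
  "sggi G rho r \<longleftrightarrow> group G
     \<and> (\<forall>i<r. rho i \<in> carrier G \<and> rho i \<noteq> \<one>\<^bsub>G\<^esub> \<and> rho i \<otimes>\<^bsub>G\<^esub> rho i = \<one>\<^bsub>G\<^esub>)
     \<and> generate G (rho ` {..<r}) = carrier G
     \<and> (\<forall>i<r. \<forall>j<r. i + 2 \<le> j \<or> j + 2 \<le> i \<longrightarrow>
           (rho i \<otimes>\<^bsub>G\<^esub> rho j) \<otimes>\<^bsub>G\<^esub> (rho i \<otimes>\<^bsub>G\<^esub> rho j) = \<one>\<^bsub>G\<^esub>)"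

definition intersection_property :: "('a, 'b) monoid_scheme \<Rightarrow> (nat \<Rightarrow> 'a) \<Rightarrow> nat \<Rightarrow> bool" where
  "intersection_property G rho r \<longleftrightarrow>
     (\<forall>J K. J \<subseteq> {..<r} \<longrightarrow> K \<subseteq> {..<r} \<longrightarrow>
        generate G (rho ` J) \<inter> generate G (rho ` K) = generate G (rho ` (J \<inter> K)))"

definition string_C_group :: "('a, 'b) monoid_scheme \<Rightarrow> (nat \<Rightarrow> 'a) \<Rightarrow> nat \<Rightarrow> bool" where
  "string_C_group G rho r \<longleftrightarrow> sggi G rho r \<and> intersection_property G rho r"

definition schlafli_type :: "('a, 'b) monoid_scheme \<Rightarrow> (nat \<Rightarrow> 'a) \<Rightarrow> nat \<Rightarrow> nat list \<Rightarrow> bool" where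
  "schlafli_type G rho r ps \<longleftrightarrow> length ps = r - 1 \<and>
     (\<forall>i. 1 \<le> i \<and> i \<le> r - 1 \<longrightarrow> ps ! (i - 1) = group.ord G (rho (i - 1) \<otimes>\<^bsub>G\<^esub> rho i))"

text \<open>A labelled graph is given as a set of pairs (label, edge); an edge with several labels
  appears once per label. rho_k swaps the two ends of every edge carrying label k
  (these edges being pairwise disjoint) and fixes all other points.\<close>
definition graph_perm :: "(nat \<times> nat set) set \<Rightarrow> nat \<Rightarrow> nat \<Rightarrow> nat" where
  "graph_perm E k v = (if \<exists>u. (k, {v, u}) \<in> E \<and> u \<noteq> v
                        then (THE u. (k, {v, u}) \<in> E \<and> u \<noteq> v) else v)"

text \<open>The graph of the theorem, with vertex set {1..n}: x_s = s for 1 \<le> s \<le> n-10, and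
  a = n-9, b = n-8, c = n-7, d = n-6, e = n-5, f = n-4, g = n-3, h = n-2, k = n-1, m = n.\<close>
definition thm414_edges :: "nat \<Rightarrow> (nat \<times> nat set) set" where
  "thm414_edges n =
     {(if odd s then 1 else 0, {s, s + 1}) | s. 1 \<le> s \<and> s \<le> n - 11}
     \<union> (let a = n - 9; b = n - 8; c = n - 7; d = n - 6; e = n - 5; f = n - 4;
            g = n - 3; h = n - 2; k = n - 1; m = n in
        {(1, {n - 10, a}), (2, {a, b}), (3, {b, c}), (4, {c, d}), (4, {e, f}), (3, {f, g}),
         (2, {c, e}), (2, {d, f}), (4, {h, k}), (3, {k, m}),
         (1, {h, e}), (3, {h, e}), (1, {k, f}),
         (1, {m, g}), (2, {m, g}), (4, {m, g})})"

definition thm414_rho :: "nat \<Rightarrow> nat \<Rightarrow> nat \<Rightarrow> nat" where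
  "thm414_rho n i = graph_perm (thm414_edges n) i"

definition thm414_group :: "nat \<Rightarrow> (nat \<Rightarrow> nat) monoid" where
  "thm414_group n = (sym_group n)\<lparr>carrier := generate (sym_group n) (thm414_rho n ` {..<5})\<rparr>"

end

theory Submission
  imports Defs
begin

text \<open>
  Write \<open>G\<^sub>J\<close> for the subgroup generated by the \<open>\<rho>\<^sub>j\<close> with \<open>j \<in> J\<close>. Because generators at distance at least two commute,
  the intersection property reduces to the inclusions \<open>G\<^bsub>{i..p}\<^esub> \<inter> G\<^bsub>{i+1..4}\<^esub> \<subseteq> G\<^bsub>{i+1..p}\<^esub>\<close>. The subgroup
  \<open>G\<^bsub>{1..4}\<^esub>\<close> is finite independently of \<open>n\<close>: it is \<open>L\<^sub>2(11) \<times> C\<^sub>2\<close>, acting on the eleven points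
  \<open>x\<^bsub>n-10\<^esub>, a, \<dots>, m\<close>, while \<open>\<rho>\<^sub>1\<close> swaps all remaining pairs \<open>x\<^bsub>2s-1\<^esub>, x\<^bsub>2s\<^esub>\<close> simultaneously.
  Each inclusion follows from a list of coset representatives for one of the groups together with point sets
  that the other group preserves and that every nontrivial representative moves. The list is independent of \<open>n\<close> except for the dihedral group
  \<open>G\<^bsub>{0,1}\<^esub>\<close>, where it consists of the powers of \<open>\<rho>\<^sub>0\<rho>\<^sub>1\<close>, an \<open>(n-9)\<close>-cycle on the path.

  If \<open>g \<in> G\<^bsub>{1..4}\<^esub>\<close> fixes \<open>x\<^sub>1, \<dots>, x\<^bsub>n-11\<^esub>\<close> and sends \<open>x\<^bsub>n-10\<^esub>\<close> to \<open>y\<close>, then \<open>\<rho>\<^sub>0\<close> and its conjugate by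
  \<open>g\<close> share all transpositions but one, so their product is a 3-cycle \<open>(x\<^bsub>n-11\<^esub> y x\<^bsub>n-10\<^esub>)\<close>. Conjugating these
  gives all 3-cycles, hence the alternating group; all generators are even because \<open>n \<equiv> 3\<close> modulo 4.
\<close>

section \<open>Intersection property of string groups\<close>

context group
begin

lemma generate_commute:
  assumes "A \<subseteq> carrier G" "B \<subseteq> carrier G"
    and comm: "\<And>a b. a \<in> A \<Longrightarrow> b \<in> B \<Longrightarrow> a \<otimes> b = b \<otimes> a"
    and "x \<in> generate G A" "y \<in> generate G B"
  shows "x \<otimes> y = y \<otimes> x"
proof -
  have carr: "generate G A \<subseteq> carrier G" "generate G B \<subseteq> carrier G"
    using assms(1,2) generate_incl by auto
  \<comment> \<open>Applied twice below: to \<open>A\<close> against a single generator in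
    \<open>B\<close>, then to \<open>B\<close> against the whole element \<open>x\<close>.\<close>
  have step: "x \<otimes> b = b \<otimes> x"
    if "X \<subseteq> carrier G" "b \<in> carrier G" "\<And>a. a \<in> X \<Longrightarrow> a \<otimes> b = b \<otimes> a" "x \<in> generate G X"
    for X b x
    using that(4)
  proof induction
    case one
    then show ?case using that(2) by simp
  next
    case (incl h)
    then show ?case using that(3) by blast
  next
    case (inv h)
    then have h: "h \<in> carrier G" "h \<otimes> b = b \<otimes> h" using that by blast+
    have "inv h \<otimes> b = inv h \<otimes> (b \<otimes> h) \<otimes> inv h"
      using h(1) that(2) by (simp add: m_assoc)
    also have "\<dots> = inv h \<otimes> (h \<otimes> b) \<otimes> inv h"
      by (simp only: h(2))
    also have "\<dots> = b \<otimes> inv h"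
      using h(1) that(2) by (simp flip: m_assoc)
    finally show ?case .
  next
    case (eng h1 h2)
    then have "h1 \<in> carrier G" "h2 \<in> carrier G"
      using generate_incl[OF that(1)] by auto
    then show ?case
      using eng.IH that(2) by (metis m_assoc)
  qed
  have xb: "x \<otimes> b = b \<otimes> x" if "b \<in> B" for b
    using step[OF assms(1), of b x] comm that assms by blast
  show ?thesis
    using step[OF assms(2), of x y] xb assms(4,5) carr by (metis subsetD)
qed

lemma generate_Un_commuting:
  assumes AB: "A \<subseteq> carrier G" "B \<subseteq> carrier G"
    and comm: "\<And>a b. a \<in> A \<Longrightarrow> b \<in> B \<Longrightarrow> a \<otimes> b = b \<otimes> a"
    and "x \<in> generate G (A \<union> B)"
  shows "\<exists>y\<in>generate G A. \<exists>z\<in>generate G B. x = y \<otimes> z"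
  using assms(4)
proof induction
  case one
  then show ?case by (metis generate.one l_one one_closed)
next
  case (incl h)
  then show ?case
    using AB generate.incl generate.one by (metis Un_iff l_one r_one subsetD)
next
  case (inv h)
  then show ?case
    using AB generate.inv generate.one by (metis Un_iff inv_closed l_one r_one subsetD)
next
  case (eng h1 h2)
  then obtain y1 z1 y2 z2 where yz: "y1 \<in> generate G A" "z1 \<in> generate G B" "h1 = y1 \<otimes> z1"
    "y2 \<in> generate G A" "z2 \<in> generate G B" "h2 = y2 \<otimes> z2"
    by blast
  have "y2 \<otimes> z1 = z1 \<otimes> y2"
    using generate_commute[OF AB comm yz(4) yz(2)] by blast
  moreover have "{y1, z1, y2, z2} \<subseteq> carrier G"
    using yz generate_incl[OF AB(1)] generate_incl[OF AB(2)] by auto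
  ultimately have "h1 \<otimes> h2 = (y1 \<otimes> y2) \<otimes> (z1 \<otimes> z2)"
    unfolding yz(3,6) by (simp add: m_assoc) (metis m_assoc)
  then show ?case using yz generate.eng by metis
qed

text \<open>Right multiplication by a generator maps the union of the cosets of
  \<open>generate G B\<close> represented by \<open>W\<close> into itself. This union contains the
  identity, hence all of \<open>generate G A\<close>. As generators are involutions, inverses need
  no separate treatment.\<close>

lemma generate_involutions_coset_cover:
  assumes A: "A \<subseteq> carrier G" "\<And>a. a \<in> A \<Longrightarrow> a \<otimes> a = \<one>"
    and B: "B \<subseteq> carrier G" and W: "W \<subseteq> carrier G" "\<one> \<in> W"
    and cover: "\<And>w a. w \<in> W \<Longrightarrow> a \<in> A \<Longrightarrow> \<exists>h\<in>generate G B. \<exists>w'\<in>W. w \<otimes> a = h \<otimes> w'"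
    and x: "x \<in> generate G A"
  shows "\<exists>h\<in>generate G B. \<exists>w\<in>W. x = h \<otimes> w"
proof -
  \<comment> \<open>All starting points \<open>w\<close> are included because in a product the
    second factor starts from the representative that the first one reaches.\<close>
  have "\<forall>w\<in>W. \<exists>h\<in>generate G B. \<exists>w'\<in>W. w \<otimes> x = h \<otimes> w'"
    using x
  proof induction
    case one
    then show ?case
      using W generate.one[of G B] by force
  next
    case (incl h)
    then show ?case using cover by blast
  next
    case (inv h)
    then have "inv h = h" using A by (meson inv_equality subsetD)
    then show ?case using cover inv by metis
  next
    case (eng h1 h2)
    show ?case
    proof
      fix w assume w: "w \<in> W"
      with eng obtain k w' where kw: "k \<in> generate G B" "w' \<in> W" "w \<otimes> h1 = k \<otimes> w'" by blast
      with eng obtain k' w'' where kw': "k' \<in> generate G B" "w'' \<in> W" "w' \<otimes> h2 = k' \<otimes> w''" by blast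
      have carr: "{h1, h2, w, k, k', w', w''} \<subseteq> carrier G"
        using W w kw kw' eng generate_incl[OF A(1)] generate_incl[OF B] by auto
      have "w \<otimes> (h1 \<otimes> h2) = (k \<otimes> k') \<otimes> w''"
        using carr kw(3) kw'(3) by (metis insert_subset m_assoc)
      then show "\<exists>h\<in>generate G B. \<exists>w'\<in>W. w \<otimes> (h1 \<otimes> h2) = h \<otimes> w'"
        using kw kw' generate.eng by metis
    qed
  qed
  moreover have "\<one> \<otimes> x = x"
    using x generate_incl[OF A(1)] by auto
  ultimately show ?thesis using W by metis
qed

text \<open>Cut \<open>J\<close> after the longest run of consecutive indices from \<open>i\<close>.
  The index \<open>p + 1\<close> is missing, so every later index is at distance at least two from
  the run and its generator commutes with the run.\<close>

lemma string_generate_split: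
  fixes rho :: "nat \<Rightarrow> 'a"
  assumes carr: "\<And>j. j < r \<Longrightarrow> rho j \<in> carrier G"
    and comm: "\<And>j k. j < r \<Longrightarrow> k < r \<Longrightarrow> j + 2 \<le> k \<Longrightarrow> rho j \<otimes> rho k = rho k \<otimes> rho j"
    and J: "J \<subseteq> {i..<r}" "i \<in> J"
  obtains p J' where "i \<le> p" "p < r" "J = {i..p} \<union> J'" "J' \<subseteq> {p + 2..<r}"
    "\<And>x. x \<in> generate G (rho ` J) \<Longrightarrow>
       \<exists>y\<in>generate G (rho ` {i..p}). \<exists>z\<in>generate G (rho ` J'). x = y \<otimes> z"
proof -
  define p where "p = (GREATEST p. {i..p} \<subseteq> J \<and> i \<le> p)"
  have ex: "{i..i} \<subseteq> J \<and> i \<le> i" using J by simp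
  have bd: "q \<le> r" if "{i..q} \<subseteq> J \<and> i \<le> q" for q
    using J that by (metis atLeastAtMost_iff atLeastLessThan_iff less_imp_le order_refl subsetD)
  have p: "{i..p} \<subseteq> J \<and> i \<le> p"
    unfolding p_def by (rule GreatestI_nat[where P = "\<lambda>p. {i..p} \<subseteq> J \<and> i \<le> p", OF ex]) (use bd in blast)
  have max: "q \<le> p" if "{i..q} \<subseteq> J \<and> i \<le> q" for q
    unfolding p_def by (rule Greatest_le_nat[where P = "\<lambda>p. {i..p} \<subseteq> J \<and> i \<le> p", OF that]) (use bd in blast)
  define J' where "J' = J - {i..p}"
  have "p + 1 \<notin> J"
  proof
    assume "p + 1 \<in> J"
    then have "{i..p + 1} \<subseteq> J" using p by (auto simp: le_Suc_eq)
    then show False using max[of "p + 1"] p by simp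
  qed
  then have "k \<noteq> Suc p" if "k \<in> J'" for k using that by (auto simp: J'_def)
  then have J': "J' \<subseteq> {p + 2..<r}" using J by (force simp: J'_def not_le less_Suc_eq_le Suc_le_eq order_less_le)
  have pr: "p < r" using p J by (metis atLeastAtMost_iff atLeastLessThan_iff order_refl subsetD)
  show ?thesis
  proof
    show "i \<le> p" "p < r" "J = {i..p} \<union> J'" "J' \<subseteq> {p + 2..<r}"
      using p pr J' by (auto simp: J'_def)
    fix x assume x: "x \<in> generate G (rho ` J)"
    have "rho ` J = rho ` {i..p} \<union> rho ` J'" using p by (auto simp: J'_def)
    then have x': "x \<in> generate G (rho ` {i..p} \<union> rho ` J')" using x by simp
    show "\<exists>y\<in>generate G (rho ` {i..p}). \<exists>z\<in>generate G (rho ` J'). x = y \<otimes> z"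
    proof (rule generate_Un_commuting[OF _ _ _ x'])
      show "rho ` {i..p} \<subseteq> carrier G" "rho ` J' \<subseteq> carrier G"
        using carr pr J' by (auto dest!: subsetD)
      show "a \<otimes> b = b \<otimes> a" if ab: "a \<in> rho ` {i..p}" "b \<in> rho ` J'" for a b
      proof -
        obtain j k where jk: "j \<in> {i..p}" "a = rho j" "k \<in> J'" "b = rho k" using ab by blast
        then have "k \<in> {p + 2..<r}" using J' by blast
        then show ?thesis using jk comm[of j k] pr by auto
      qed
    qed
  qed
qed

text \<open>Downward induction on the lower bound of the index sets. The run of consecutive indices
  at the bottom splits off as a factor, so only such runs have to be compared with the group of all
  higher generators.\<close>

lemma intersection_property_from_intervals:
  fixes rho :: "nat \<Rightarrow> 'a"
  assumes carr: "\<And>j. j < r \<Longrightarrow> rho j \<in> carrier G"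
    and comm: "\<And>j k. j < r \<Longrightarrow> k < r \<Longrightarrow> j + 2 \<le> k \<Longrightarrow> rho j \<otimes> rho k = rho k \<otimes> rho j"
    and intervals: "\<And>i p x. i \<le> p \<Longrightarrow> p + 1 < r \<Longrightarrow> x \<in> generate G (rho ` {i..p}) \<Longrightarrow>
      x \<in> generate G (rho ` {i + 1..<r}) \<Longrightarrow> x \<in> generate G (rho ` {i + 1..p})"
  shows "intersection_property G rho r"
proof -
  let ?g = "\<lambda>J. generate G (rho ` J)"
  have sub: "subgroup (?g J) G" if "J \<subseteq> {..<r}" for J
    by (rule generate_is_subgroup) (use carr that in auto)
  have mono: "?g J \<subseteq> ?g K" if "J \<subseteq> K" for J K
    by (rule mono_generate) (use that in blast)
  have intervals': "x \<in> ?g {i + 1..p}"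
    if "i \<le> p" "p < r" "x \<in> ?g {i..p}" "x \<in> ?g {i + 1..<r}" for i p x
  proof (cases "p + 1 < r")
    case True
    then show ?thesis using intervals that by blast
  next
    case False
    then have "{i + 1..<r} = {i + 1..p}" using that(2) by auto
    then show ?thesis using that by simp
  qed
  have right: "z \<in> ?g K" if "y \<in> ?g K" "y \<otimes> z \<in> ?g K" "z \<in> ?g J" "K \<subseteq> {..<r}" "J \<subseteq> {..<r}" for y z J K
  proof -
    have "y \<in> carrier G" "z \<in> carrier G" using that sub subgroup.mem_carrier by metis+
    then have "z = inv y \<otimes> (y \<otimes> z)" by (simp flip: m_assoc)
    then show ?thesis using that sub[of K] by (metis subgroup.m_closed subgroup.m_inv_closed)
  qed
  have left: "y \<in> ?g K" if "z \<in> ?g K" "y \<otimes> z \<in> ?g K" "y \<in> ?g J" "K \<subseteq> {..<r}" "J \<subseteq> {..<r}" for y z J K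
  proof -
    have "y \<in> carrier G" "z \<in> carrier G" using that sub subgroup.mem_carrier by metis+
    then have "y = y \<otimes> z \<otimes> inv z" by (simp add: m_assoc)
    then show ?thesis using that sub[of K] by (metis subgroup.m_closed subgroup.m_inv_closed)
  qed
  have main: "\<forall>J K. J \<subseteq> {i..<r} \<longrightarrow> K \<subseteq> {i..<r} \<longrightarrow> ?g J \<inter> ?g K \<subseteq> ?g (J \<inter> K)" if "i \<le> r" for i
    using that
  proof (induction rule: inc_induct)
    case base
    then show ?case using mono by simp
  next
    case (step i)
    \<comment> \<open>The factor over \<open>J'\<close> already lies in the group of higher
      generators, so the factor over \<open>{i..p}\<close> does too, and the interval hypothesis
      removes \<open>i\<close> from it.\<close>
    have drop: "x \<in> ?g (J - {i})"
      if J: "J \<subseteq> {i..<r}" "i \<in> J" and x: "x \<in> ?g J" "x \<in> ?g {i + 1..<r}" for J x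
    proof -
      obtain p J' where p: "i \<le> p" "p < r" "J = {i..p} \<union> J'" "J' \<subseteq> {p + 2..<r}"
        and dec: "\<And>x. x \<in> ?g J \<Longrightarrow> \<exists>y\<in>?g {i..p}. \<exists>z\<in>?g J'. x = y \<otimes> z"
        using string_generate_split[of r rho J i, OF carr comm J] by blast
      obtain y z where yz: "y \<in> ?g {i..p}" "z \<in> ?g J'" "x = y \<otimes> z" using dec x by blast
      have "z \<in> ?g {i + 1..<r}" using yz(2) mono[of J' "{i + 1..<r}"] p by fastforce
      moreover have "{i + 1..<r} \<subseteq> {..<r}" "{i..p} \<subseteq> {..<r}" using p by auto
      ultimately have "y \<in> ?g {i + 1..<r}"
        using left x(2) yz by metis
      then have "y \<in> ?g {i + 1..p}" using intervals' p yz by blast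
      moreover have "{i + 1..p} \<subseteq> J - {i}" "J' \<subseteq> J - {i}" using p by auto
      ultimately have "y \<in> ?g (J - {i})" "z \<in> ?g (J - {i})" using mono yz by blast+
      then show ?thesis unfolding yz(3) by (rule generate.eng)
    qed
    have one_sided: "?g J \<inter> ?g K \<subseteq> ?g (J \<inter> K)"
      if JK: "J \<subseteq> {i..<r}" "K \<subseteq> {i..<r}" "i \<notin> K" for J K
    proof
      fix x assume x: "x \<in> ?g J \<inter> ?g K"
      have K: "K \<subseteq> {i + 1..<r}" using JK by (force simp: Suc_le_eq order_less_le)
      have J: "J - {i} \<subseteq> {i + 1..<r}" using JK by (force simp: Suc_le_eq order_less_le)
      have "x \<in> ?g (J - {i})"
      proof (cases "i \<in> J")
        case True
        then show ?thesis using drop[of J x] JK x mono[OF K] by blast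
      qed (use x in auto)
      then have "x \<in> ?g ((J - {i}) \<inter> K)" using step.IH J K x by auto
      moreover have "(J - {i}) \<inter> K = J \<inter> K" using JK by auto
      ultimately show "x \<in> ?g (J \<inter> K)" by simp
    qed
    \<comment> \<open>When both sets contain \<open>i\<close>, the shorter initial run is contained
      in the other set. Its factor \<open>y\<close> then lies in both groups, and the remaining
      factor \<open>z\<close> has an index set without \<open>i\<close>.\<close>
    have both: "?g J \<inter> ?g K \<subseteq> ?g (J \<inter> K)"
      if JK: "J \<subseteq> {i..<r}" "K \<subseteq> {i..<r}" and p: "i \<le> p" "p < r" "J = {i..p} \<union> J'" "J' \<subseteq> {p + 2..<r}"
        "{i..p} \<subseteq> K"
        and dec: "\<And>x. x \<in> ?g J \<Longrightarrow> \<exists>y\<in>?g {i..p}. \<exists>z\<in>?g J'. x = y \<otimes> z"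
      for J K p J'
    proof
      fix x assume x: "x \<in> ?g J \<inter> ?g K"
      then obtain y z where yz: "y \<in> ?g {i..p}" "z \<in> ?g J'" "x = y \<otimes> z" using dec by blast
      have y: "y \<in> ?g K" "y \<in> ?g (J \<inter> K)"
        using yz(1) mono[of "{i..p}" K] mono[of "{i..p}" "J \<inter> K"] p by auto
      have "K \<subseteq> {..<r}" "J' \<subseteq> {..<r}" using JK p(3) by auto
      then have "z \<in> ?g K" using right[OF y(1) _ yz(2)] x yz(3) by blast
      then have "z \<in> ?g (K \<inter> J')"
        using one_sided[of K J'] JK p yz by fastforce
      then have "z \<in> ?g (J \<inter> K)" using mono[of "K \<inter> J'" "J \<inter> K"] p by blast
      then show "x \<in> ?g (J \<inter> K)" unfolding yz(3) using y generate.eng by metis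
    qed
    show ?case
    proof (intro allI impI)
      fix J K assume JK: "J \<subseteq> {i..<r}" "K \<subseteq> {i..<r}"
      consider "i \<notin> J" | "i \<notin> K" | "i \<in> J" "i \<in> K" by blast
      then show "?g J \<inter> ?g K \<subseteq> ?g (J \<inter> K)"
      proof cases
        case 1
        then show ?thesis using one_sided[of K J] JK by (simp add: Int_commute)
      next
        case 2
        then show ?thesis using one_sided JK by blast
      next
        case 3
        obtain p J' where p: "i \<le> p" "p < r" "J = {i..p} \<union> J'" "J' \<subseteq> {p + 2..<r}"
          and dJ: "\<And>x. x \<in> ?g J \<Longrightarrow> \<exists>y\<in>?g {i..p}. \<exists>z\<in>?g J'. x = y \<otimes> z"
          using string_generate_split[of r rho J i, OF carr comm JK(1) 3(1)] by blast
        obtain q K' where q: "i \<le> q" "q < r" "K = {i..q} \<union> K'" "K' \<subseteq> {q + 2..<r}"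
          and dK: "\<And>x. x \<in> ?g K \<Longrightarrow> \<exists>y\<in>?g {i..q}. \<exists>z\<in>?g K'. x = y \<otimes> z"
          using string_generate_split[of r rho K i, OF carr comm JK(2) 3(2)] by blast
        show ?thesis
        proof (cases "p \<le> q")
          case True
          then have "{i..p} \<subseteq> K" using q by auto
          then show ?thesis using both[OF JK p _ dJ] by blast
        next
          case False
          then have "{i..q} \<subseteq> J" using p by auto
          then show ?thesis using both[OF JK(2,1) q _ dK] by (simp add: Int_commute)
        qed
      qed
    qed
  qed
  show ?thesis
    unfolding intersection_property_def
  proof (intro allI impI equalityI)
    fix J K assume "J \<subseteq> {..<r}" "K \<subseteq> {..<r}"
    then show "?g J \<inter> ?g K \<subseteq> ?g (J \<inter> K)" using main[of 0] by (simp add: lessThan_atLeast0)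
    show "?g (J \<inter> K) \<subseteq> ?g J \<inter> ?g K" using mono by blast
  qed
qed

end

section \<open>Three-cycles and powers of permutations\<close>

text \<open>The form to which \<open>cycle_of_list [i, j, k]\<close> unfolds: \<open>i\<close> goes
  to \<open>j\<close>, \<open>j\<close> to \<open>k\<close>, \<open>k\<close> to
  \<open>i\<close>.\<close>

definition three_cycle :: "'a \<Rightarrow> 'a \<Rightarrow> 'a \<Rightarrow> 'a \<Rightarrow> 'a" where
  "three_cycle i j k = transpose i j \<circ> transpose j k"

lemma three_cycle_apply:
  "i \<noteq> j \<Longrightarrow> i \<noteq> k \<Longrightarrow> j \<noteq> k \<Longrightarrow>
    three_cycle i j k v = (if v = i then j else if v = j then k else if v = k then i else v)"
  by (simp add: three_cycle_def transpose_def)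

lemma three_cycle_rotate: "i \<noteq> j \<Longrightarrow> i \<noteq> k \<Longrightarrow> j \<noteq> k \<Longrightarrow> three_cycle i j k = three_cycle j k i"
  by (rule ext) (simp add: three_cycle_apply)

lemma three_cycle_conjugate:
  assumes "bij g"
  shows "g \<circ> three_cycle i j k \<circ> inv' g = three_cycle (g i) (g j) (g k)"
proof -
  have t: "g \<circ> transpose a b = transpose (g a) (g b) \<circ> g" for a b
    using bij_is_inj[OF assms] by (auto simp: fun_eq_iff transpose_def inj_eq)
  have "g \<circ> three_cycle i j k \<circ> inv' g = three_cycle (g i) (g j) (g k) \<circ> (g \<circ> inv' g)"
    unfolding three_cycle_def by (metis t comp_assoc)
  then show ?thesis using iffD1[OF surj_iff bij_is_surj[OF assms]] by simp
qed

lemma subgroup_three_cycle_conjugate: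
  assumes H: "subgroup H (sym_group n)" and "g \<in> H" "three_cycle i j k \<in> H"
  shows "three_cycle (g i) (g j) (g k) \<in> H"
proof -
  have g: "g \<in> carrier (sym_group n)" using subgroup.mem_carrier assms by metis
  then have "bij g" using sym_group_carrier permutes_bij by blast
  moreover have "inv' g \<in> H"
    using subgroup.m_inv_closed[OF H assms(2)] sym_group_inv_equality[OF g] by simp
  then have "g \<circ> three_cycle i j k \<circ> inv' g \<in> H"
    using assms subgroup.m_closed[OF H] by (metis sym_group_mult)
  ultimately show ?thesis using three_cycle_conjugate by metis
qed

text \<open>Conjugating the 3-cycles through \<open>b\<close>, \<open>c\<close> by one another
  produces every 3-cycle, and 3-cycles generate the alternating group.\<close>

lemma alternating_subgroup_of_star:
  assumes H: "subgroup H (sym_group n)" and bc: "b \<noteq> c"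
    and star: "\<And>z. z \<in> {1..n} \<Longrightarrow> z \<noteq> b \<Longrightarrow> z \<noteq> c \<Longrightarrow> three_cycle b c z \<in> H"
  shows "carrier (alt_group n) \<subseteq> H"
proof -
  let ?T = "\<lambda>i j k. three_cycle i j k \<in> H"
  define R where "R = {1..n} - {b, c}"
  note conj = subgroup_three_cycle_conjugate[OF H]
  have bcz: "?T b c z" if "z \<in> R" for z using star that by (auto simp: R_def)
  have ne: "z \<noteq> b" "z \<noteq> c" "b \<noteq> z" "c \<noteq> z" if "z \<in> R" for z using that by (auto simp: R_def)
  \<comment> \<open>Conjugation by \<open>three_cycle b c w\<close> acts on the entries:
    \<open>b\<close>, \<open>c\<close>, \<open>z\<close> become \<open>c\<close>, \<open>w\<close>,
    \<open>z\<close>, and these in turn become \<open>w\<close>, \<open>b\<close>,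
    \<open>z\<close>.\<close>
  have cwz: "?T c w z" if "w \<in> R" "z \<in> R" "w \<noteq> z" for w z
    using conj[OF bcz[OF that(1)] bcz[OF that(2)]] that(3) ne[OF that(1)] ne[OF that(2)] bc
    by (simp add: three_cycle_apply)
  have wbz: "?T w b z" if "w \<in> R" "z \<in> R" "w \<noteq> z" for w z
    using conj[OF bcz[OF that(1)] cwz[OF that]] that(3) ne[OF that(1)] ne[OF that(2)] bc
    by (simp add: three_cycle_apply)
  have ywz: "?T y w z" if "y \<in> R" "w \<in> R" "z \<in> R" "w \<noteq> z" "y \<noteq> w" "y \<noteq> z" for y w z
  proof -
    have "?T c y b"
      using bcz[OF that(1)] three_cycle_rotate[of b c y] ne[OF that(1)] bc by metis
    from conj[OF this cwz[OF that(2,3,4)]] show ?thesis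
      using that(4-6) ne[OF that(1)] ne[OF that(2)] ne[OF that(3)] bc by (simp add: three_cycle_apply)
  qed
  have rot: "?T j k i \<and> ?T k i j" if "?T i j k" "i \<noteq> j" "i \<noteq> k" "j \<noteq> k" for i j k
    using that three_cycle_rotate[of i j k] three_cycle_rotate[of j k i] by metis
  have no_bc: "?T i j k" if "{i, j, k} \<subseteq> {1..n}" "i \<noteq> j" "i \<noteq> k" "j \<noteq> k" "k \<in> R" for i j k
  proof -
    consider "i \<in> R" "j \<in> R" | "i = b" "j = c" | "i = c" "j = b" | "i = b" "j \<in> R" | "i = c" "j \<in> R"
      | "i \<in> R" "j = b" | "i \<in> R" "j = c"
    proof -
      have "i \<in> R \<or> i = b \<or> i = c" "j \<in> R \<or> j = b \<or> j = c" using \<open>{i, j, k} \<subseteq> {1..n}\<close> by (auto simp: R_def)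
      then show thesis using \<open>i \<noteq> j\<close> that by blast
    qed
    then show ?thesis
    proof cases
      case 1 then show ?thesis using ywz that by blast
    next
      case 2 then show ?thesis using bcz that by blast
    next
      case 3
      \<comment> \<open>The opposite orientation is the inverse, which for a 3-cycle is the
        square.\<close>
      have "three_cycle b c k \<circ> three_cycle b c k \<in> H"
        using subgroup.m_closed[OF H bcz[OF that(5)] bcz[OF that(5)]] by (simp only: sym_group_mult)
      moreover have "three_cycle b c k \<circ> three_cycle b c k = three_cycle c b k"
        using ne[OF that(5)] bc by (auto simp: fun_eq_iff three_cycle_apply)
      ultimately show ?thesis using 3 by simp
    next
      case 4 then show ?thesis using wbz[of k j] rot[of k i j] that by metis
    next
      case 5 then show ?thesis using cwz that by blast
    next
      case 6 then show ?thesis using wbz that by blast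
    next
      case 7 then show ?thesis using cwz[of k i] rot[of j k i] that by metis
    qed
  qed
  have all: "?T i j k" if "{i, j, k} \<subseteq> {1..n}" "i \<noteq> j" "i \<noteq> k" "j \<noteq> k" for i j k
  proof -
    \<comment> \<open>Three distinct entries cannot all be \<open>b\<close> or \<open>c\<close>;
      rotation brings one outside these two to the last place.\<close>
    have "k \<in> R \<or> i \<in> R \<or> j \<in> R" using that by (simp add: R_def) metis
    then consider "k \<in> R" | "i \<in> R" | "j \<in> R" by blast
    then show ?thesis
    proof cases
      case 1 then show ?thesis using no_bc that by blast
    next
      case 2 then show ?thesis using no_bc[of j k i] rot[of j k i] that by auto
    next
      case 3 then show ?thesis using no_bc[of k i j] rot[of k i j] that by auto
    qed
  qed
  have "three_cycles n \<subseteq> H"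
  proof
    fix p assume "p \<in> three_cycles n"
    then obtain cs where cs: "p = cycle_of_list cs" "distinct cs" "length cs = 3" "set cs \<subseteq> {1..n}"
      by auto
    then obtain i j k where "cs = [i, j, k]" by (auto simp: length_Suc_conv numeral_3_eq_3)
    then show "p \<in> H" using all[of i j k] cs by (simp add: three_cycle_def)
  qed
  moreover have "carrier (alt_group n) = generate (sym_group n) (three_cycles n)"
    using group.generate_consistent[OF sym_group_is_group _ alt_group_is_subgroup, of "three_cycles n" n]
      three_cycles_incl alt_group_carrier_as_three_cycles
    by (simp add: alt_group_def)
  ultimately show ?thesis
    using group.generate_subgroup_incl[OF sym_group_is_group _ H] by simp
qed

text \<open>The conjugate of \<open>\<sigma>\<close> by \<open>g\<close> agrees with
  \<open>\<sigma>\<close> below \<open>p\<close> but exchanges \<open>p\<close> with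
  \<open>y\<close> instead of \<open>q\<close>, and the product of these two transpositions is a
  3-cycle. Composing with \<open>g\<close> on the right avoids its inverse.\<close>

lemma three_cycle_eq_conjugate_product:
  fixes g \<sigma> :: "nat \<Rightarrow> nat"
  assumes g: "inj g" "\<And>v. v < q \<Longrightarrow> g v = v" "g q = y" "q < y"
    and \<sigma>: "\<sigma> \<circ> \<sigma> = id" "\<sigma> q = p" "p < q" "\<And>v. v < p \<Longrightarrow> \<sigma> v < p" "\<And>v. q < v \<Longrightarrow> \<sigma> v = v"
    and pq: "Suc p = q"
  shows "three_cycle p y q \<circ> g = \<sigma> \<circ> g \<circ> \<sigma>"
proof
  fix v
  have \<sigma>\<sigma>: "\<sigma> (\<sigma> w) = w" for w using fun_cong[OF \<sigma>(1), of w] by simp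
  have cyc: "three_cycle p y q w = (if w = p then y else if w = y then q else if w = q then p else w)" for w
    using \<sigma>(3) g(4) by (intro three_cycle_apply) auto
  have \<sigma>p: "\<sigma> p = q" using \<sigma>\<sigma>[of q] \<sigma>(2) by simp
  consider "v < p" | "v = p" | "v = q" | "v > q" using pq by linarith
  then show "(three_cycle p y q \<circ> g) v = (\<sigma> \<circ> g \<circ> \<sigma>) v"
  proof cases
    case 1
    then have "g v = v" "g (\<sigma> v) = \<sigma> v" using \<sigma>(3) \<sigma>(4)[OF 1] by (auto intro!: g(2))
    then show ?thesis using 1 \<sigma>(3) g(4) by (simp add: cyc \<sigma>\<sigma>)
  next
    case 2
    then show ?thesis using g(2)[OF \<sigma>(3)] g(3) \<sigma>p \<sigma>(5)[OF g(4)] by (simp add: cyc)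
  next
    case 3
    then show ?thesis using g(2)[OF \<sigma>(3)] g(3,4) \<sigma>(2,3) \<sigma>p by (simp add: cyc)
  next
    case 4
    \<comment> \<open>By injectivity \<open>g v\<close> is neither \<open>y\<close>, the image of
      \<open>q\<close>, nor a point below \<open>q\<close>, each being its own image. So either
      \<open>g v = q\<close> and both sides give \<open>p\<close>, or both give
      \<open>g v\<close>.\<close>
    have "g v \<noteq> y" using g(1,3) 4 by (metis injD order_less_irrefl)
    moreover have "\<not> g v < q" using g(2)[of "g v"] injD[OF g(1)] 4 by (metis order_less_asym)
    ultimately show ?thesis using \<sigma>(2,3) \<sigma>(5)[OF 4] \<sigma>(5)[of "g v"] by (cases "g v = q") (auto simp: cyc)
  qed
qed

section \<open>Iterates and orders\<close>

lemma pow_eq_funpow: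
  fixes x :: "'a \<Rightarrow> 'a"
  assumes "mult G = (\<circ>)" "one G = id"
  shows "x [^]\<^bsub>G\<^esub> (k::nat) = x ^^ k"
proof (induction k)
  case 0
  show ?case by (simp only: nat_pow_0 assms(2) funpow.simps)
next
  case (Suc k)
  have "x [^]\<^bsub>G\<^esub> Suc k = (x ^^ k) \<circ> x"
    unfolding nat_pow_Suc Suc assms(1) ..
  then show ?case by (simp only: funpow_Suc_right)
qed

lemma funpow_eq_id_iff_dvd:
  assumes "f ^^ d = id" "0 < d" "\<And>k. 0 < k \<Longrightarrow> k < d \<Longrightarrow> f ^^ k \<noteq> id"
  shows "f ^^ k = id \<longleftrightarrow> d dvd k"
proof
  assume k: "f ^^ k = id"
  have "f ^^ k = f ^^ (k mod d + d * (k div d))" by simp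
  also have "\<dots> = f ^^ (k mod d)"
    by (subst funpow_add) (simp only: funpow_mult[symmetric] assms(1) id_funpow comp_id)
  finally have "f ^^ (k mod d) = id" using k by simp
  then have "k mod d = 0" using assms(2) assms(3)[of "k mod d"] by auto
  then show "d dvd k" by auto
next
  assume "d dvd k"
  then obtain q where "k = d * q" by blast
  then have "f ^^ k = (f ^^ d) ^^ q" by (simp only: funpow_mult)
  then show "f ^^ k = id" by (simp only: assms(1) id_funpow)
qed

section \<open>The generators as permutations\<close>

text \<open>The product of \<open>m\<close> disjoint transpositions: \<open>a\<close> with
  \<open>a + 1\<close>, \<open>a + 2\<close> with \<open>a + 3\<close>, and so on. Labels 0 and 1
  act on the path in this way.\<close>

definition adjacent_swaps :: "nat \<Rightarrow> nat \<Rightarrow> nat \<Rightarrow> nat" where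
  "adjacent_swaps a m v = (if a \<le> v \<and> v < a + 2 * m then (if even (v - a) then v + 1 else v - 1) else v)"

text \<open>Moved pairs appear symmetrically in \<open>u\<close> and \<open>v\<close> and are
  indexed by their smaller point, the shape that path edges have in
  \<open>thm414_edges_iff\<close>.\<close>

lemma adjacent_swaps_iff:
  "u = adjacent_swaps a m v \<and> adjacent_swaps a m v \<noteq> v \<longleftrightarrow>
     (u = v + 1 \<and> a \<le> v \<and> v < a + 2 * m \<and> even (v - a)) \<or>
     (v = u + 1 \<and> a \<le> u \<and> u < a + 2 * m \<and> even (u - a))"
proof (cases "a \<le> v")
  case True
  then obtain w where w: "v = a + w" by (metis le_add_diff_inverse)
  show ?thesis
  proof (cases "a \<le> u")
    case True
    then obtain x where x: "u = a + x" by (metis le_add_diff_inverse)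
    show ?thesis unfolding w x by (cases w; cases x) (auto simp: adjacent_swaps_def intro: odd_pos)
  next
    case False
    then show ?thesis unfolding w by (cases w) (auto simp: adjacent_swaps_def)
  qed
qed (auto simp: adjacent_swaps_def)

lemma adjacent_swaps_Suc:
  "adjacent_swaps a (Suc m) = transpose (a + 2 * m) (a + 2 * m + 1) \<circ> adjacent_swaps a m"
proof
  fix v
  consider "v < a" | "a \<le> v" "v < a + 2 * m" | "v = a + 2 * m" | "v = a + 2 * m + 1" | "v > a + 2 * m + 1"
    by linarith
  then show "adjacent_swaps a (Suc m) v = (transpose (a + 2 * m) (a + 2 * m + 1) \<circ> adjacent_swaps a m) v"
  proof cases
    case 2
    then have "even (v - a) \<Longrightarrow> v + 1 < a + 2 * m" by presburger
    then show ?thesis using 2 by (auto simp: adjacent_swaps_def transpose_def)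
  qed (auto simp: adjacent_swaps_def transpose_def)
qed

lemma adjacent_swaps_permutes_even:
  "adjacent_swaps a m permutes {a..<a + 2 * m} \<and> (evenperm (adjacent_swaps a m) \<longleftrightarrow> even m)"
proof (induction m)
  case 0
  have "adjacent_swaps a 0 = id" by (rule ext) (simp add: adjacent_swaps_def)
  then show ?case by (metis permutes_id evenperm_id even_zero)
next
  case (Suc m)
  let ?t = "transpose (a + 2 * m) (a + 2 * m + 1)"
  have "?t permutes {a..<a + 2 * Suc m}"
    by (rule permutes_swap_id) auto
  moreover have "adjacent_swaps a m permutes {a..<a + 2 * Suc m}"
    by (rule permutes_subset[of _ "{a..<a + 2 * m}"]) (use Suc in auto)
  ultimately have "?t \<circ> adjacent_swaps a m permutes {a..<a + 2 * Suc m}"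
    by (metis permutes_compose)
  moreover have "permutation (adjacent_swaps a m)"
    using Suc permutation_permutes by blast
  then have "evenperm (?t \<circ> adjacent_swaps a m) \<longleftrightarrow> even (Suc m)"
    using Suc evenperm_comp[OF permutation_swap_id, of "adjacent_swaps a m" "a + 2 * m" "a + 2 * m + 1"]
    by (simp add: evenperm_swap)
  ultimately show ?case
    unfolding adjacent_swaps_Suc by blast
qed

section \<open>Reading the generators off the edges\<close>

lemma graph_perm_eqI:
  assumes "\<And>u v. (k, {v, u}) \<in> E \<and> u \<noteq> v \<longleftrightarrow> u = f v \<and> f v \<noteq> v"
  shows "graph_perm E k = f"
proof
  fix v
  have "(THE u. (k, {v, u}) \<in> E \<and> u \<noteq> v) = f v" if "f v \<noteq> v"
    using assms that by (intro the_equality) auto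
  then show "graph_perm E k v = f v"
    using assms by (auto simp: graph_perm_def)
qed

lemma Ex_doubleton_Suc:
  "(\<exists>s. (k, {v, u}) = (f s, {s, s + 1}) \<and> P s) \<longleftrightarrow>
     (u = v + 1 \<and> k = f v \<and> P v) \<or> (v = u + 1 \<and> k = f u \<and> P (u::nat))"
  by (auto simp: doubleton_eq_iff)

text \<open>Writing \<open>n\<close> as \<open>N + 15\<close> turns the truncated differences into
  sums, so that simplification can tell the vertices apart.\<close>

lemma thm414_edges_iff:
  "(k, {v, u}) \<in> thm414_edges (N + 15) \<longleftrightarrow>
     (u = v + 1 \<and> k = (if odd v then 1 else 0) \<and> 1 \<le> v \<and> v \<le> N + 4) \<or>
     (v = u + 1 \<and> k = (if odd u then 1 else 0) \<and> 1 \<le> u \<and> u \<le> N + 4) \<or>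
     (k, {v, u}) \<in> {(1, {N + 5, N + 6}), (2, {N + 6, N + 7}), (3, {N + 7, N + 8}),
       (4, {N + 8, N + 9}), (4, {N + 10, N + 11}), (3, {N + 11, N + 12}), (2, {N + 8, N + 10}),
       (2, {N + 9, N + 11}), (4, {N + 13, N + 14}), (3, {N + 14, N + 15}),
       (1, {N + 13, N + 10}), (3, {N + 13, N + 10}), (1, {N + 14, N + 11}),
       (1, {N + 15, N + 12}), (2, {N + 15, N + 12}), (4, {N + 15, N + 12})}"
proof -
  have diff: "N + 15 - 1 = N + 14" "N + 15 - 2 = N + 13" "N + 15 - 3 = N + 12"
    "N + 15 - 4 = N + 11" "N + 15 - 5 = N + 10" "N + 15 - 6 = N + 9"
    "N + 15 - 7 = N + 8" "N + 15 - 8 = N + 7" "N + 15 - 9 = N + 6" "N + 15 - 10 = N + 5" "N + 15 - 11 = N + 4"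
    by simp_all
  have "(k, {v, u}) \<in> {(if odd s then 1 else 0, {s, s + 1}) | s. 1 \<le> s \<and> s \<le> N + 15 - 11} \<longleftrightarrow>
     (u = v + 1 \<and> k = (if odd v then 1 else 0) \<and> 1 \<le> v \<and> v \<le> N + 4) \<or>
     (v = u + 1 \<and> k = (if odd u then 1 else 0) \<and> 1 \<le> u \<and> u \<le> N + 4)"
    unfolding mem_Collect_eq diff(11) by (rule Ex_doubleton_Suc)
  moreover have "thm414_edges (N + 15) =
    {(if odd s then 1 else 0, {s, s + 1}) | s. 1 \<le> s \<and> s \<le> N + 15 - 11} \<union>
    {(1, {N + 5, N + 6}), (2, {N + 6, N + 7}), (3, {N + 7, N + 8}),
       (4, {N + 8, N + 9}), (4, {N + 10, N + 11}), (3, {N + 11, N + 12}), (2, {N + 8, N + 10}),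
       (2, {N + 9, N + 11}), (4, {N + 13, N + 14}), (3, {N + 14, N + 15}),
       (1, {N + 13, N + 10}), (3, {N + 13, N + 10}), (1, {N + 14, N + 11}),
       (1, {N + 15, N + 12}), (2, {N + 15, N + 12}), (4, {N + 15, N + 12})}"
    by (simp only: thm414_edges_def Let_def diff)
  ultimately show ?thesis
    by (simp only: Un_iff disj_assoc)
qed

lemma thm414_rho_0:
  assumes "4 dvd N"
  shows "thm414_rho (N + 15) 0 = adjacent_swaps 2 ((N + 4) div 2)"
  unfolding thm414_rho_def
proof (rule graph_perm_eqI)
  fix u v
  obtain K where K: "N = 2 * K" using assms by (metis dvdE dvd_mult_left numeral_Bit0 mult_2)
  have even_iff: "2 \<le> w \<and> w < 2 + 2 * (K + 2) \<and> even (w - 2) \<longleftrightarrow> 1 \<le> w \<and> w \<le> N + 4 \<and> even w" for w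
    unfolding K by (cases "2 \<le> w") (auto, presburger)
  show "(0, {v, u}) \<in> thm414_edges (N + 15) \<and> u \<noteq> v \<longleftrightarrow>
    u = adjacent_swaps 2 ((N + 4) div 2) v \<and> adjacent_swaps 2 ((N + 4) div 2) v \<noteq> v"
    unfolding adjacent_swaps_iff thm414_edges_iff using even_iff[of u] even_iff[of v] K by auto
qed

text \<open>The edge from \<open>N + 5\<close> to \<open>N + 6\<close> prolongs the path with label
  1, so the path contributes one block of \<open>(N + 6) div 2\<close> swaps covering 1 to
  \<open>N + 6\<close>. Three separate edges remain.\<close>

lemma thm414_rho_1_apply:
  assumes "4 dvd N"
  shows "thm414_rho (N + 15) 1 v = (if v = N + 13 then N + 10 else if v = N + 10 then N + 13 else
     if v = N + 14 then N + 11 else if v = N + 11 then N + 14 else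
     if v = N + 15 then N + 12 else if v = N + 12 then N + 15 else
     adjacent_swaps 1 ((N + 6) div 2) v)"
    (is "_ = ?f v")
proof -
  obtain K where K: "N = 2 * K" using assms by (metis dvdE dvd_mult_left numeral_Bit0 mult_2)
  have odd_iff: "1 \<le> w \<and> w < 1 + 2 * (K + 3) \<and> even (w - 1) \<longleftrightarrow> 1 \<le> w \<and> w \<le> N + 5 \<and> odd w" for w
    unfolding K by (cases w) (auto, presburger)
  have large: "adjacent_swaps 1 (K + 3) v = v" if "v \<ge> N + 7" for v
    using that by (simp add: adjacent_swaps_def K)
  have "graph_perm (thm414_edges (N + 15)) 1 = ?f"
  proof (rule graph_perm_eqI)
    fix u v
    have path_end: "{v, u} = {N + 5, N + 6} \<longleftrightarrow> (u = v + 1 \<and> v = N + 5) \<or> (v = u + 1 \<and> u = N + 5)"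
      by (auto simp: doubleton_eq_iff)
    have split: "1 \<le> w \<and> w \<le> N + 5 \<and> odd w \<longleftrightarrow> (1 \<le> w \<and> w \<le> N + 4 \<and> odd w) \<or> w = N + 5" for w
      unfolding K by auto
    have distinct: "u \<noteq> v" if "{v, u} \<in> {{N + 13, N + 10}, {N + 14, N + 11}, {N + 15, N + 12}}"
      using that by (auto simp: doubleton_eq_iff)
    have "(1, {v, u}) \<in> thm414_edges (N + 15) \<longleftrightarrow>
      (u = v + 1 \<and> 1 \<le> v \<and> v \<le> N + 4 \<and> odd v) \<or> (v = u + 1 \<and> 1 \<le> u \<and> u \<le> N + 4 \<and> odd u) \<or>
      {v, u} = {N + 5, N + 6} \<or> {v, u} \<in> {{N + 13, N + 10}, {N + 14, N + 11}, {N + 15, N + 12}}"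
      by (simp add: thm414_edges_iff)
    then have "(1, {v, u}) \<in> thm414_edges (N + 15) \<and> u \<noteq> v \<longleftrightarrow>
      (u = v + 1 \<and> 1 \<le> v \<and> v \<le> N + 5 \<and> odd v) \<or> (v = u + 1 \<and> 1 \<le> u \<and> u \<le> N + 5 \<and> odd u) \<or>
       {v, u} \<in> {{N + 13, N + 10}, {N + 14, N + 11}, {N + 15, N + 12}}"
      unfolding path_end split using distinct by (metis n_not_Suc_n Suc_eq_plus1)
    also have "\<dots> \<longleftrightarrow> (u = adjacent_swaps 1 (K + 3) v \<and> adjacent_swaps 1 (K + 3) v \<noteq> v) \<or>
       {v, u} \<in> {{N + 13, N + 10}, {N + 14, N + 11}, {N + 15, N + 12}}"
      by (simp only: adjacent_swaps_iff odd_iff disj_assoc)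
    also have "\<dots> \<longleftrightarrow> u = ?f v \<and> ?f v \<noteq> v"
      using large[of v] K by (auto simp: doubleton_eq_iff)
    finally show "(1, {v, u}) \<in> thm414_edges (N + 15) \<and> u \<noteq> v \<longleftrightarrow> u = ?f v \<and> ?f v \<noteq> v" .
  qed
  then show ?thesis by (simp add: thm414_rho_def)
qed

lemma thm414_rho_1:
  assumes "4 dvd N"
  shows "thm414_rho (N + 15) 1 = adjacent_swaps 1 ((N + 6) div 2) \<circ>
    transpose (N + 13) (N + 10) \<circ> transpose (N + 14) (N + 11) \<circ> transpose (N + 15) (N + 12)"
proof
  fix v
  have large: "adjacent_swaps 1 ((N + 6) div 2) v = v" if "v \<ge> N + 7" for v
    using that by (simp add: adjacent_swaps_def)
  show "thm414_rho (N + 15) 1 v = (adjacent_swaps 1 ((N + 6) div 2) \<circ>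
    transpose (N + 13) (N + 10) \<circ> transpose (N + 14) (N + 11) \<circ> transpose (N + 15) (N + 12)) v"
    unfolding thm414_rho_1_apply[OF assms]
    using large[of "N + 10"] large[of "N + 11"] large[of "N + 12"] large[of "N + 13"]
      large[of "N + 14"] large[of "N + 15"]
    by (simp add: transpose_def)
qed

lemma thm414_rho_2:
  "thm414_rho (N + 15) 2 = transpose (N + 6) (N + 7) \<circ> transpose (N + 8) (N + 10) \<circ>
    transpose (N + 9) (N + 11) \<circ> transpose (N + 15) (N + 12)"
  unfolding thm414_rho_def
  by (rule graph_perm_eqI) (auto simp: thm414_edges_iff doubleton_eq_iff transpose_def split: if_splits)

lemma thm414_rho_3:
  "thm414_rho (N + 15) 3 = transpose (N + 7) (N + 8) \<circ> transpose (N + 11) (N + 12) \<circ>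
    transpose (N + 14) (N + 15) \<circ> transpose (N + 13) (N + 10)"
  unfolding thm414_rho_def
  by (rule graph_perm_eqI) (auto simp: thm414_edges_iff doubleton_eq_iff transpose_def split: if_splits)

lemma thm414_rho_4:
  "thm414_rho (N + 15) 4 = transpose (N + 8) (N + 9) \<circ> transpose (N + 10) (N + 11) \<circ>
    transpose (N + 13) (N + 14) \<circ> transpose (N + 15) (N + 12)"
  unfolding thm414_rho_def
  by (rule graph_perm_eqI) (auto simp: thm414_edges_iff doubleton_eq_iff transpose_def split: if_splits)

section \<open>Coset tables\<close>

text \<open>\<open>Px\<close> is \<open>x\<^bsub>n-10\<^esub>\<close>, and \<open>Podd, Peven\<close> stand for any pair \<open>x\<^sub>s, x\<^bsub>s+1\<^esub>\<close> with odd \<open>s \<le> n - 12\<close>; the generators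
  \<open>\<rho>\<^sub>1, \<dots>, \<rho>\<^sub>4\<close> act in the same way on all these pairs.\<close>

datatype point = Px | Pa | Pb | Pc | Pd | Pe | Pf | Pg | Ph | Pk | Pm | Podd | Peven

primrec point_rho1 :: "point \<Rightarrow> point" where
  "point_rho1 Px = Pa" | "point_rho1 Pa = Px" | "point_rho1 Pb = Pb" | "point_rho1 Pc = Pc"
| "point_rho1 Pd = Pd" | "point_rho1 Pe = Ph" | "point_rho1 Pf = Pk" | "point_rho1 Pg = Pm"
| "point_rho1 Ph = Pe" | "point_rho1 Pk = Pf" | "point_rho1 Pm = Pg"
| "point_rho1 Podd = Peven" | "point_rho1 Peven = Podd"

primrec point_rho2 :: "point \<Rightarrow> point" where
  "point_rho2 Px = Px" | "point_rho2 Pa = Pb" | "point_rho2 Pb = Pa" | "point_rho2 Pc = Pe"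
| "point_rho2 Pd = Pf" | "point_rho2 Pe = Pc" | "point_rho2 Pf = Pd" | "point_rho2 Pg = Pm"
| "point_rho2 Ph = Ph" | "point_rho2 Pk = Pk" | "point_rho2 Pm = Pg"
| "point_rho2 Podd = Podd" | "point_rho2 Peven = Peven"

primrec point_rho3 :: "point \<Rightarrow> point" where
  "point_rho3 Px = Px" | "point_rho3 Pa = Pa" | "point_rho3 Pb = Pc" | "point_rho3 Pc = Pb"
| "point_rho3 Pd = Pd" | "point_rho3 Pe = Ph" | "point_rho3 Pf = Pg" | "point_rho3 Pg = Pf"
| "point_rho3 Ph = Pe" | "point_rho3 Pk = Pm" | "point_rho3 Pm = Pk"
| "point_rho3 Podd = Podd" | "point_rho3 Peven = Peven"

primrec point_rho4 :: "point \<Rightarrow> point" where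
  "point_rho4 Px = Px" | "point_rho4 Pa = Pa" | "point_rho4 Pb = Pb" | "point_rho4 Pc = Pd"
| "point_rho4 Pd = Pc" | "point_rho4 Pe = Pf" | "point_rho4 Pf = Pe" | "point_rho4 Pg = Pm"
| "point_rho4 Ph = Pk" | "point_rho4 Pk = Ph" | "point_rho4 Pm = Pg"
| "point_rho4 Podd = Podd" | "point_rho4 Peven = Peven"

text \<open>Meant for indices 1 to 4; the last branch is a default elsewhere. Words are read as
  permutations of the vertices by \<open>run\<close> only when their letters lie in
  \<open>{1..4}\<close>.\<close>

definition point_rho :: "nat \<Rightarrow> point \<Rightarrow> point" where
  "point_rho i = (if i = 1 then point_rho1 else if i = 2 then point_rho2
     else if i = 3 then point_rho3 else point_rho4)"

lemma point_rho_simps [simp]: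
  "point_rho 1 = point_rho1" "point_rho (Suc 0) = point_rho1"
  "point_rho 2 = point_rho2" "point_rho 3 = point_rho3" "point_rho 4 = point_rho4"
  by (simp_all add: point_rho_def)

text \<open>The last letter acts first, in agreement with composition of functions.\<close>

primrec run :: "nat list \<Rightarrow> point \<Rightarrow> point" where
  "run [] p = p"
| "run (i # w) p = point_rho i (run w p)"

lemma all_point:
  "(\<forall>p. P p) \<longleftrightarrow> P Px \<and> P Pa \<and> P Pb \<and> P Pc \<and> P Pd \<and> P Pe \<and> P Pf \<and> P Pg \<and> P Ph \<and> P Pk \<and> P Pm
     \<and> P Podd \<and> P Peven" (is "_ \<longleftrightarrow> ?all")
proof
  assume ?all
  show "\<forall>p. P p"
  proof
    show "P p" for p using \<open>?all\<close> by (cases p) simp_all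
  qed
qed simp

text \<open>An entry \<open>(h, w')\<close> in the row of \<open>w\<close> at generator \<open>a\<close> records \<open>w a = h w'\<close>, so the words \<open>w\<close> represent all right
  cosets of \<open>\<langle>B\<rangle>\<close> in \<open>\<langle>A\<rangle>\<close>; each \<open>w \<noteq> []\<close> moves one of the sets in \<open>\<S>\<close>.\<close>

definition coset_table ::
    "nat list \<Rightarrow> nat list \<Rightarrow> point set list \<Rightarrow> (nat list \<times> (nat list \<times> nat list) list) list \<Rightarrow> bool" where
  "coset_table A B \<S> T \<longleftrightarrow> [] \<in> fst ` set T \<and>
     list_all (\<lambda>(w, row). set w \<subseteq> set A \<and> (w = [] \<or> list_ex (\<lambda>S. \<exists>p\<in>S. run w p \<notin> S) \<S>) \<and>
       list_all2 (\<lambda>a (h, w'). (\<forall>p. run (w @ [a]) p = run (h @ w') p) \<and> set h \<subseteq> set B \<and> w' \<in> fst ` set T) A row) T"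

text \<open>The chosen point is moved by generator \<open>i\<close> and fixed by generators
  \<open>i + 1\<close> to 4.\<close>

lemma coset_table_involution: "coset_table [i] [] [S] [([], [([], [i])]), ([i], [([], [])])]"
  if "(i, S) \<in> {(1, {Podd}), (2, {Pa}), (3, {Pb})}"
  using that by (auto simp: coset_table_def all_point)

text \<open>Eleven representatives. The five points form an orbit of \<open>point_rho1\<close>,
  \<open>point_rho2\<close>, \<open>point_rho3\<close>, and their places are fixed by
  \<open>\<rho> 0\<close>; \<open>point_rho4\<close> takes \<open>Pd\<close> out of the set.\<close>

lemma coset_table_1234_123:
  "coset_table [1,2,3,4] [1,2,3] [{Pd, Pf, Pg, Pk, Pm}]
    [([], [([1], []), ([2], []), ([3], []), ([], [4])]),
     ([4], [([1], [4]), ([2], [4]), ([], [4,3]), ([], [])]),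
     ([4,3], [([1], [4,3]), ([], [4,3,2]), ([], [4]), ([3], [4,3])]),
     ([4,3,2], [([], [4,3,2,1]), ([], [4,3]), ([], [4,3,2,3]), ([3], [4,3,2])]),
     ([4,3,2,1], [([], [4,3,2]), ([2,1,2,1,2], [4,3,2,1]), ([], [4,3,2,1,3]), ([3], [4,3,2,1])]),
     ([4,3,2,3], [([], [4,3,2,1,3]), ([], [4,3,2,3,2]), ([], [4,3,2]), ([2,3,2,3,2], [4,3,2,3,2])]),
     ([4,3,2,1,3], [([], [4,3,2,3]), ([], [4,3,2,1,3,2]), ([], [4,3,2,1]), ([], [4,3,2,1,3,4])]),
     ([4,3,2,3,2], [([2,3,2,3,2], [4,3,2,1,3,4]), ([], [4,3,2,3]), ([2], [4,3,2,3,2]), ([2,3,2,3,2], [4,3,2,3])]),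
     ([4,3,2,1,3,2], [([], [4,3,2,1,3,2,1]), ([], [4,3,2,1,3]), ([2,1,2], [4,3,2,1,3,2,1]), ([1,2,1,2,1,3,2,3,2], [4,3,2,1,3,2,1])]),
     ([4,3,2,1,3,4], [([2,3,2,3,2], [4,3,2,3,2]), ([1,2,1,2,1,3,2,3,2], [4,3,2,1,3,2,1]), ([3], [4,3,2,1,3,4]), ([], [4,3,2,1,3])]),
     ([4,3,2,1,3,2,1], [([], [4,3,2,1,3,2]), ([1,2,1,2,1,3,2,3,2], [4,3,2,1,3,4]), ([2,1,2], [4,3,2,1,3,2]), ([1,2,1,2,1,3,2,3,2], [4,3,2,1,3,2])])]"
  by (simp add: coset_table_def all_point)

lemma coset_table_123_12:
  "coset_table [1,2,3] [1,2] [{Pg, Pm}]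
    [([], [([1], []), ([2], []), ([], [3])]),
     ([3], [([1], [3]), ([], [3,2]), ([], [])]),
     ([3,2], [([], [3,2,1]), ([], [3]), ([], [3,2,3])]),
     ([3,2,1], [([], [3,2]), ([2,1,2,1,2], [3,2,1]), ([], [3,2,1,3])]),
     ([3,2,3], [([], [3,2,1,3]), ([], [3,2,3,2]), ([], [3,2])]),
     ([3,2,1,3], [([], [3,2,3]), ([], [3,2,1,3,2]), ([], [3,2,1])]),
     ([3,2,3,2], [([], [3,2,3,2,1]), ([], [3,2,3]), ([2], [3,2,3,2])]),
     ([3,2,1,3,2], [([], [3,2,1,3,2,1]), ([], [3,2,1,3]), ([2,1,2], [3,2,1,3,2,1])]),
     ([3,2,3,2,1], [([], [3,2,3,2]), ([1,2,1,2,1,2], [3,2,1,3,2,1]), ([2], [3,2,3,2,1])]),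
     ([3,2,1,3,2,1], [([], [3,2,1,3,2]), ([1,2,1,2,1,2], [3,2,3,2,1]), ([2,1,2], [3,2,1,3,2])])]"
  by (simp add: coset_table_def all_point)

text \<open>Words with an odd number of letters 1 move \<open>Podd\<close>; the other nonempty ones
  move \<open>Px\<close>. The same two tests serve the table for 1, 2, 3 over 2, 3.\<close>

lemma coset_table_12_2:
  "coset_table [1,2] [2] [{Podd}, {Px}]
    [([], [([], [1]), ([2], [])]),
     ([1], [([], []), ([], [1,2])]),
     ([1,2], [([], [1,2,1]), ([], [1])]),
     ([1,2,1], [([], [1,2]), ([], [1,2,1,2])]),
     ([1,2,1,2], [([], [1,2,1,2,1]), ([], [1,2,1])]),
     ([1,2,1,2,1], [([], [1,2,1,2]), ([2], [1,2,1,2,1])])]"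
  by (simp add: coset_table_def all_point)

lemma coset_table_123_23:
  "coset_table [1,2,3] [2,3] [{Podd}, {Px}]
    [([], [([], [1]), ([2], []), ([3], [])]),
     ([1], [([], []), ([], [1,2]), ([3], [1])]),
     ([1,2], [([], [1,2,1]), ([], [1]), ([], [1,2,3])]),
     ([1,2,1], [([], [1,2]), ([], [1,2,1,2]), ([], [1,2,1,3])]),
     ([1,2,3], [([], [1,2,1,3]), ([], [1,2,3,2]), ([], [1,2])]),
     ([1,2,1,2], [([], [1,2,1,2,1]), ([], [1,2,1]), ([2,3,2], [1,2,1,2])]),
     ([1,2,1,3], [([], [1,2,3]), ([], [1,2,1,3,2]), ([], [1,2,1])]),
     ([1,2,3,2], [([], [1,2,3,2,1]), ([], [1,2,3]), ([], [1,2,3,2,3])]),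
     ([1,2,1,2,1], [([], [1,2,1,2]), ([2], [1,2,1,2,1]), ([2,3,2], [1,2,1,2,1])]),
     ([1,2,1,3,2], [([3,2,3,2], [1,2,3,2,3]), ([], [1,2,1,3]), ([3,2,3,2], [1,2,3,2,1])]),
     ([1,2,3,2,1], [([], [1,2,3,2]), ([2], [1,2,3,2,1]), ([2,3,2,3], [1,2,1,3,2])]),
     ([1,2,3,2,3], [([2,3,2,3], [1,2,1,3,2]), ([3], [1,2,3,2,3]), ([], [1,2,3,2])])]"
  by (simp add: coset_table_def all_point)

lemma coset_table_23_3:
  "coset_table [2,3] [3] [{Pa}]
    [([], [([], [2]), ([3], [])]),
     ([2], [([], []), ([], [2,3])]),
     ([2,3], [([], [2,3,2]), ([], [2])]),
     ([2,3,2], [([], [2,3]), ([], [2,3,2,3])]),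
     ([2,3,2,3], [([3], [2,3,2,3]), ([], [2,3,2])])]"
  by (simp add: coset_table_def all_point)

lemma coset_table_row:
  assumes "coset_table A B \<S> T" "(w, row) \<in> set T"
  shows "set w \<subseteq> set A" "w = [] \<or> list_ex (\<lambda>S. \<exists>p\<in>S. run w p \<notin> S) \<S>"
    "list_all2 (\<lambda>a (h, w'). (\<forall>p. run (w @ [a]) p = run (h @ w') p) \<and> set h \<subseteq> set B \<and> w' \<in> fst ` set T) A row"
  using assms(1) bspec[OF _ assms(2)] unfolding coset_table_def list_all_iff by blast+

lemma foldr_comp_append:
  "foldr (\<circ>) (map f (u @ w)) id = foldr (\<circ>) (map f u) id \<circ> foldr (\<circ>) (map f w) id"
  by (induction u) (simp_all add: comp_assoc)

lemma generate_sym_group_image: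
  assumes "x \<in> generate (sym_group n) A" "A \<subseteq> carrier (sym_group n)" "\<And>a. a \<in> A \<Longrightarrow> a ` S = S"
  shows "x ` S = S"
  using assms(1)
proof induction
  case (inv h)
  then have "h permutes {1..n}" using assms(2) sym_group_carrier by blast
  then have "bij h" by (rule permutes_bij)
  moreover have "inv\<^bsub>sym_group n\<^esub> h = inv' h"
    using inv assms(2) by (intro sym_group_inv_equality) blast
  ultimately show ?case
    using assms(3)[OF inv] by (metis bij_betw_def image_inv_f_f)
next
  case (eng h1 h2)
  then show ?case by (metis sym_group_mult image_comp)
qed (use assms in \<open>auto simp: sym_group_one\<close>)

section \<open>The group of the graph\<close>

text \<open>For \<open>n = N + 15\<close> the condition \<open>n mod 4 = 3\<close> becomes
  \<open>4 dvd N\<close>.\<close>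

locale thm414 =
  fixes N :: nat
  assumes N: "4 dvd N"
begin

abbreviation "\<rho> \<equiv> thm414_rho (N + 15)"
abbreviation "Sym \<equiv> sym_group (N + 15)"
abbreviation "gen J \<equiv> generate Sym (\<rho> ` J)"

definition word :: "nat list \<Rightarrow> nat \<Rightarrow> nat" where
  "word w = foldr (\<circ>) (map \<rho> w) id"

text \<open>The parameter \<open>s\<close>, odd and at most \<open>N + 3\<close> in use, selects the
  pair of path vertices for which \<open>Podd\<close> and \<open>Peven\<close> stand.\<close>

primrec place :: "nat \<Rightarrow> point \<Rightarrow> nat" where
  "place s Px = N + 5" | "place s Pa = N + 6" | "place s Pb = N + 7" | "place s Pc = N + 8"
| "place s Pd = N + 9" | "place s Pe = N + 10" | "place s Pf = N + 11" | "place s Pg = N + 12"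
| "place s Ph = N + 13" | "place s Pk = N + 14" | "place s Pm = N + 15"
| "place s Podd = s" | "place s Peven = s + 1"

lemma group_Sym: "group Sym"
  by (rule sym_group_is_group)

lemma word_simps: "word [] = id" "word (i # w) = \<rho> i \<circ> word w" "word (u @ w) = word u \<circ> word w"
  by (simp_all only: word_def foldr_comp_append) simp_all

lemma even_N: "even N"
  using N by presburger

lemma less_5_cases:
  assumes "i < (5::nat)"
  obtains "i = 0" | "i = 1" | "i = 2" | "i = 3" | "i = 4"
  using assms by linarith

lemma even_half: "even ((N + 4) div 2)" "odd ((N + 6) div 2)"
  using N by presburger+

text \<open>Parity by counting transpositions: \<open>\<rho> 0\<close> has
  \<open>(N + 4) div 2\<close>, an even number; \<open>\<rho> 1\<close> has the odd number
  \<open>(N + 6) div 2\<close> and three more; the others have four each.\<close>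

lemma rho_permutes_even:
  assumes "i < 5"
  shows "\<rho> i permutes {1..N + 15} \<and> evenperm (\<rho> i)"
proof -
  have swap: "transpose a b permutes {1..N + 15}" if "1 \<le> a" "1 \<le> b" "a \<le> N + 15" "b \<le> N + 15" for a b
    using that by (intro permutes_swap_id) auto
  have swaps: "adjacent_swaps a m permutes {1..N + 15}" if "1 \<le> a" "a + 2 * m \<le> N + 16" for a m
  proof (rule permutes_subset)
    show "adjacent_swaps a m permutes {a..<a + 2 * m}" using adjacent_swaps_permutes_even by blast
    show "{a..<a + 2 * m} \<subseteq> {1..N + 15}" using that by auto
  qed
  have perm: "permutation p" if "p permutes {1..N + 15}" for p
    using that permutation_permutes by blast
  have comp: "p \<circ> q permutes {1..N + 15}" if "p permutes {1..N + 15}" "q permutes {1..N + 15}" for p q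
    using that by (metis permutes_compose)
  have ev: "evenperm (p \<circ> transpose a b) \<longleftrightarrow> (evenperm p \<longleftrightarrow> a = b)" if "permutation p" for p :: "nat \<Rightarrow> nat" and a b
    using that by (simp add: evenperm_comp permutation_swap_id evenperm_swap)
  have pc: "permutation (p \<circ> transpose a b)" if "permutation p" for p :: "nat \<Rightarrow> nat" and a b
    using that by (simp add: permutation_compose permutation_swap_id)
  have dbl: "2 * ((N + 4) div 2) = N + 4" "2 * ((N + 6) div 2) = N + 6" using even_N by presburger+
  have s: "adjacent_swaps 2 ((N + 4) div 2) permutes {1..N + 15}"
    "adjacent_swaps 1 ((N + 6) div 2) permutes {1..N + 15}"
    by (rule swaps; simp add: dbl)+
  have e: "evenperm (adjacent_swaps 2 ((N + 4) div 2))" "\<not> evenperm (adjacent_swaps 1 ((N + 6) div 2))"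
    using adjacent_swaps_permutes_even even_half by blast+
  from assms show ?thesis
  proof (cases rule: less_5_cases)
    case 1
    then show ?thesis using s e by (simp add: thm414_rho_0 N)
  next
    case 2
    have "\<rho> i permutes {1..N + 15}" unfolding 2 thm414_rho_1[OF N]
      by (intro comp s swap) auto
    moreover have "evenperm (\<rho> i)" unfolding 2 thm414_rho_1[OF N]
      using e perm[OF s(2)] by (simp add: ev pc)
    ultimately show ?thesis by blast
  next
    case 3
    have "\<rho> i permutes {1..N + 15}" unfolding 3 thm414_rho_2 by (intro comp swap) auto
    then show ?thesis unfolding 3 thm414_rho_2
      by (simp add: ev pc permutation_swap_id evenperm_swap)
  next
    case 4
    have "\<rho> i permutes {1..N + 15}" unfolding 4 thm414_rho_3 by (intro comp swap) auto
    then show ?thesis unfolding 4 thm414_rho_3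
      by (simp add: ev pc permutation_swap_id evenperm_swap)
  next
    case 5
    have "\<rho> i permutes {1..N + 15}" unfolding 5 thm414_rho_4 by (intro comp swap) auto
    then show ?thesis unfolding 5 thm414_rho_4
      by (simp add: ev pc permutation_swap_id evenperm_swap)
  qed
qed

lemma rho_carrier: "i < 5 \<Longrightarrow> \<rho> i \<in> carrier Sym"
  using rho_permutes_even by (simp add: sym_group_carrier)

text \<open>Makes a computation on thirteen points valid for every \<open>N\<close>. The generator
  \<open>\<rho> 0\<close> is left out because it joins vertices of different pairs.\<close>

lemma rho_place:
  assumes i: "i \<in> {1..4}" and s: "odd s" "s \<le> N + 3"
  shows "\<rho> i (place s p) = place s (point_rho i p)"
proof -
  have s1: "1 \<le> s" using s odd_pos by fastforce
  have "i < 5" using i by simp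
  then show ?thesis
  proof (cases rule: less_5_cases)
    case 2
    have "adjacent_swaps 1 ((N + 6) div 2) s = s + 1"
      "adjacent_swaps 1 ((N + 6) div 2) (s + 1) = s"
      "adjacent_swaps 1 ((N + 6) div 2) (N + 5) = N + 6"
      "adjacent_swaps 1 ((N + 6) div 2) (N + 6) = N + 5"
      "adjacent_swaps 1 ((N + 6) div 2) (N + 7) = N + 7"
      "adjacent_swaps 1 ((N + 6) div 2) (N + 8) = N + 8"
      "adjacent_swaps 1 ((N + 6) div 2) (N + 9) = N + 9"
      using s s1 even_N by (auto simp: adjacent_swaps_def)
    then show ?thesis using s s1 unfolding 2 thm414_rho_1_apply[OF N] by (cases p) simp_all
  qed (use i s in \<open>cases p; simp add: thm414_rho_2 thm414_rho_3 thm414_rho_4 transpose_def\<close>)+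
qed

lemma word_place:
  assumes "set w \<subseteq> {1..4}" "odd s" "s \<le> N + 3"
  shows "word w (place s p) = place s (run w p)"
  using assms(1) by (induction w) (simp_all add: word_simps rho_place assms(2,3))

lemma rho_0_fix: "v \<ge> N + 6 \<Longrightarrow> \<rho> 0 v = v"
  by (simp add: thm414_rho_0 N adjacent_swaps_def)

lemma ex_place:
  assumes "v \<in> {1..N + 15}"
  obtains s p where "odd s" "s \<le> N + 3" "v = place s p"
proof -
  have "v \<le> N + 15" "1 \<le> v" using assms by auto
  then have "v \<le> N + 4 \<or> v = N + 5 \<or> v = N + 6 \<or> v = N + 7 \<or> v = N + 8 \<or> v = N + 9 \<or> v = N + 10
    \<or> v = N + 11 \<or> v = N + 12 \<or> v = N + 13 \<or> v = N + 14 \<or> v = N + 15"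
    by presburger
  then consider "v = N + 5" | "v = N + 6" | "v = N + 7" | "v = N + 8" | "v = N + 9" | "v = N + 10" | "v = N + 11"
    | "v = N + 12" | "v = N + 13" | "v = N + 14" | "v = N + 15" | "v \<le> N + 4"
    by blast
  then show ?thesis
  proof cases
    case 12
    show ?thesis
    proof (cases "odd v")
      case True
      \<comment> \<open>\<open>N + 4\<close> is even, so an odd \<open>v\<close> here is at most
        \<open>N + 3\<close> and starts a pair.\<close>
      then have "v \<noteq> N + 4" using even_N by auto
      then show ?thesis using 12 True that[of v Podd] by simp
    next
      case False
      then have "v \<ge> 2" using \<open>1 \<le> v\<close> by (cases "v = 1") auto
      then show ?thesis using that[of "v - 1" Peven] 12 False by simp
    qed
  qed (use that[of 1] place.simps in \<open>metis odd_one add_leE le_add2 one_le_numeral order_trans\<close>)+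
qed

lemma place_1_inject: "place 1 p = place 1 q \<longleftrightarrow> p = q"
  by (cases p; cases q) simp_all

lemma word_carrier: "set w \<subseteq> {..<5} \<Longrightarrow> word w \<in> carrier Sym"
proof (induction w)
  case (Cons i w)
  then have "\<rho> i permutes {1..N + 15}" "word w permutes {1..N + 15}"
    using rho_carrier[of i] by (auto simp only: sym_group_carrier set_simps insert_subset lessThan_iff)
  then show ?case
    unfolding word_simps sym_group_carrier by (metis permutes_compose)
qed (metis word_simps(1) sym_group_carrier permutes_id)

lemma word_in_gen: "set w \<subseteq> J \<Longrightarrow> word w \<in> gen J"
proof (induction w)
  case Nil
  show ?case using generate.one[of Sym] by (metis word_simps(1) sym_group_one)
next
  case (Cons i w)
  then have "\<rho> i \<in> gen J" "word w \<in> gen J" by (auto intro: generate.incl)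
  then have "\<rho> i \<otimes>\<^bsub>Sym\<^esub> word w \<in> gen J" by (rule generate.eng)
  then show ?case by (metis word_simps(2) sym_group_mult)
qed

text \<open>Every vertex is the place of a point, and off the vertex set both words are the
  identity.\<close>

lemma word_eqI:
  assumes "\<forall>p. run u p = run w p" "set u \<subseteq> {1..4}" "set w \<subseteq> {1..4}"
  shows "word u = word w"
proof
  fix v
  show "word u v = word w v"
  proof (cases "v \<in> {1..N + 15}")
    case True
    then obtain s p where "odd s" "s \<le> N + 3" "v = place s p" by (rule ex_place)
    then show ?thesis using assms by (simp add: word_place)
  next
    case False
    have "set u \<subseteq> {..<5}" "set w \<subseteq> {..<5}" using assms by fastforce+
    then have "word u permutes {1..N + 15}" "word w permutes {1..N + 15}"
      using word_carrier sym_group_carrier by blast+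
    then show ?thesis using False by (simp add: permutes_not_in)
  qed
qed

lemma rho_involution:
  assumes "i < 5"
  shows "\<rho> i \<circ> \<rho> i = id"
proof (cases "i = 0")
  case True
  have "adjacent_swaps a m (adjacent_swaps a m v) = v" for a m v
    using adjacent_swaps_iff[of "adjacent_swaps a m v" a m v] adjacent_swaps_iff[of v a m "adjacent_swaps a m v"]
    by metis
  then show ?thesis using True by (simp add: thm414_rho_0 N fun_eq_iff)
next
  case False
  have "point_rho i (point_rho i p) = p" for p
    using assms by (cases rule: less_5_cases; cases p) (use False in simp_all)
  then have "word [i, i] = word []" using assms False by (intro word_eqI) auto
  then show ?thesis by (simp only: word_simps comp_id)
qed

section \<open>From computations on points to subgroups of permutations\<close>

lemma word_eq_idD:
  assumes "word w = id" "set w \<subseteq> {1..4}"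
  shows "run w p = p"
  using word_place[of w 1 p] assms place_1_inject by simp

text \<open>By \<open>word_eqI\<close> each table entry becomes an equation between permutations,
  which is the covering hypothesis of \<open>generate_involutions_coset_cover\<close>.\<close>

lemma coset_table_cover:
  assumes T: "coset_table A B \<S> T" and A: "set A \<subseteq> {1..4}" and B: "set B \<subseteq> {1..4}"
    and x: "x \<in> gen (set A)"
  shows "\<exists>h\<in>gen (set B). \<exists>w\<in>fst ` set T. x = h \<circ> word w"
proof -
  interpret group Sym by (rule group_Sym)
  have lt: "i < 5" if "i \<in> {1..4}" for i :: nat using that by simp
  have TA: "set w \<subseteq> set A" if "w \<in> fst ` set T" for w
    using coset_table_row(1)[OF T] that by fastforce
  have "\<exists>h\<in>gen (set B). \<exists>w\<in>word ` fst ` set T. x = h \<otimes>\<^bsub>Sym\<^esub> w"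
  proof (rule generate_involutions_coset_cover[OF _ _ _ _ _ _ x])
    show "\<rho> ` set A \<subseteq> carrier Sym" "\<rho> ` set B \<subseteq> carrier Sym"
      using A B lt rho_carrier by blast+
    show "a \<otimes>\<^bsub>Sym\<^esub> a = \<one>\<^bsub>Sym\<^esub>" if "a \<in> \<rho> ` set A" for a
      using that A lt rho_involution by (auto simp: sym_group_mult sym_group_one)
    show "word ` fst ` set T \<subseteq> carrier Sym"
      using TA A lt word_carrier by (smt (verit) image_subset_iff lessThan_iff subset_iff)
    show "\<one>\<^bsub>Sym\<^esub> \<in> word ` fst ` set T"
      using T by (auto simp: coset_table_def sym_group_one word_simps intro!: image_eqI[of _ _ "[]"])
    fix w a assume "w \<in> word ` fst ` set T" "a \<in> \<rho> ` set A"
    then obtain u row i where u: "(u, row) \<in> set T" "w = word u" "i \<in> set A" "a = \<rho> i" by auto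
    obtain k where k: "k < length A" "i = A ! k" using u by (metis in_set_conv_nth)
    obtain h w' where row: "row ! k = (h, w')" by (cases "row ! k")
    have "(\<forall>p. run (u @ [i]) p = run (h @ w') p) \<and> set h \<subseteq> set B \<and> w' \<in> fst ` set T"
      using list_all2_nthD[OF coset_table_row(3)[OF T u(1)] k(1)]
      unfolding row k(2) case_prod_conv .
    note h = conjunct1[OF this] conjunct1[OF conjunct2[OF this]] conjunct2[OF conjunct2[OF this]]
    have "set u \<subseteq> {1..4}" "set w' \<subseteq> {1..4}" "i \<in> {1..4}"
      using coset_table_row(1)[OF T u(1)] TA[OF h(3)] u(3) A by blast+
    moreover have "set h \<subseteq> {1..4}" using h(2) B by blast
    ultimately have "word (u @ [i]) = word (h @ w')" using h(1) by (intro word_eqI) simp_all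
    then have "w \<otimes>\<^bsub>Sym\<^esub> a = word h \<otimes>\<^bsub>Sym\<^esub> word w'"
      using u by (simp add: word_simps sym_group_mult)
    then show "\<exists>h\<in>gen (set B). \<exists>w'\<in>word ` fst ` set T. w \<otimes>\<^bsub>Sym\<^esub> a = h \<otimes>\<^bsub>Sym\<^esub> w'"
      using h(3) word_in_gen[OF h(2)] by blast
  qed
  then show ?thesis by (auto simp: sym_group_mult)
qed

text \<open>Write \<open>x = h \<circ> word w\<close> from the table. Both \<open>x\<close> and
  \<open>h\<close> lie in \<open>gen K\<close> and preserve the places of the test sets; hence so
  does \<open>word w\<close>, which forces \<open>w = []\<close> and \<open>x = h\<close>. If
  \<open>0 \<in> K\<close>, the test sets must consist of points that \<open>\<rho> 0\<close>
  fixes.\<close>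

lemma coset_table_intersection:
  assumes T: "coset_table A B \<S> T" and A: "set A \<subseteq> {1..4}" and B: "set B \<subseteq> K" and K: "K \<subseteq> {..<5}"
    and inv: "\<And>S k. S \<in> set \<S> \<Longrightarrow> k \<in> K \<Longrightarrow> k \<noteq> 0 \<Longrightarrow> point_rho k ` S = S"
    and inv0: "\<And>S. S \<in> set \<S> \<Longrightarrow> 0 \<in> K \<Longrightarrow> S \<subseteq> {Pd, Pf, Pg, Pk, Pm}"
    and B4: "set B \<subseteq> {1..4}"
    and x: "x \<in> gen (set A)" "x \<in> gen K"
  shows "x \<in> gen (set B)"
proof -
  obtain h w where hw: "h \<in> gen (set B)" "w \<in> fst ` set T" "x = h \<circ> word w"
    using coset_table_cover[OF T A B4 x(1)] by blast
  have "gen (set B) \<subseteq> gen K" using B by (intro group.mono_generate[OF group_Sym]) blast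
  then have hK: "h \<in> gen K" using hw by blast
  have carr: "\<rho> ` K \<subseteq> carrier Sym" using K rho_carrier by blast
  have rhoS: "\<rho> k ` place 1 ` S = place 1 ` S" if "S \<in> set \<S>" "k \<in> K" for S k
  proof (cases "k = 0")
    case True
    have "\<rho> 0 v = v" if "v \<in> place 1 ` S" for v
      using that inv0[OF \<open>S \<in> set \<S>\<close>] \<open>k \<in> K\<close> True by (intro rho_0_fix) auto
    then show ?thesis using True by simp
  next
    case False
    then have "k \<in> {1..4}" using that K by fastforce
    then have "\<rho> k ` place 1 ` S = place 1 ` point_rho k ` S"
      unfolding image_image by (intro image_cong refl rho_place) auto
    then show ?thesis using inv that False by simp
  qed
  have "w = []"
  proof (rule ccontr)
    assume "w \<noteq> []"
    obtain row where "(w, row) \<in> set T" using hw(2) by auto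
    from coset_table_row(2)[OF T this] obtain S p where S: "S \<in> set \<S>" "p \<in> S" "run w p \<notin> S"
      using \<open>w \<noteq> []\<close> unfolding list_ex_iff by blast
    have hS: "h ` place 1 ` S = place 1 ` S"
      by (rule generate_sym_group_image[OF hK carr]) (use rhoS[OF S(1)] in blast)
    have xS: "x ` place 1 ` S = place 1 ` S"
      by (rule generate_sym_group_image[OF x(2) carr]) (use rhoS[OF S(1)] in blast)
    have "h permutes {1..N + 15}"
      using hK group.generate_incl[OF group_Sym carr] sym_group_carrier by blast
    then have "inj h" by (rule permutes_inj)
    have "set w \<subseteq> {1..4}" using coset_table_row(1)[OF T] hw(2) A by fastforce
    then have "h (place 1 (run w p)) = x (place 1 p)" using hw(3) by (simp add: word_place)
    then have "h (place 1 (run w p)) \<in> h ` place 1 ` S" using xS hS S by blast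
    then have "place 1 (run w p) \<in> place 1 ` S" using \<open>inj h\<close> by (simp add: inj_image_mem_iff)
    then show False using S place_1_inject by auto
  qed
  then show ?thesis using hw by (simp add: word_simps)
qed

section \<open>The dihedral group of the path\<close>

definition rotation :: "nat \<Rightarrow> nat" where
  "rotation = \<rho> 0 \<circ> \<rho> 1"

lemma rotation_apply: "rotation v = \<rho> 0 (\<rho> 1 v)"
  by (simp add: rotation_def)

lemma rho_1_path:
  assumes "v \<le> N + 6"
  shows "\<rho> 1 v = (if odd v then v + 1 else v - 1)"
  using assms even_N unfolding thm414_rho_1_apply[OF N]
  by (cases "v = 0") (auto simp: adjacent_swaps_def)

lemma rho_0_path: "\<rho> 0 v = (if 2 \<le> v \<and> v \<le> N + 5 then if even v then v + 1 else v - 1 else v)"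
  using even_N unfolding thm414_rho_0[OF N] by (auto simp: adjacent_swaps_def)

text \<open>The cycle climbs through the odd vertices 1, 3, ..., \<open>N + 5\<close> and returns
  through the even ones \<open>N + 6\<close>, ..., 4, 2.\<close>

lemma rotation_step:
  "odd v \<Longrightarrow> v \<le> N + 3 \<Longrightarrow> rotation v = v + 2"
  "rotation (N + 5) = N + 6"
  "4 \<le> v \<Longrightarrow> even v \<Longrightarrow> v \<le> N + 6 \<Longrightarrow> rotation v = v - 2"
  "rotation 2 = 1"
proof -
  show "rotation v = v + 2" if "odd v" "v \<le> N + 3"
  proof -
    have "\<rho> 1 v = v + 1" "2 \<le> v + 1" "v + 1 \<le> N + 5"
      using that rho_1_path[of v] by (auto simp: Suc_le_eq odd_pos)
    then show ?thesis using that unfolding rotation_apply rho_0_path by simp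
  qed
  show "rotation (N + 5) = N + 6"
    using even_N rho_1_path[of "N + 5"] by (simp add: rotation_apply rho_0_path)
  show "rotation v = v - 2" if "4 \<le> v" "even v" "v \<le> N + 6"
  proof -
    have "\<rho> 1 v = v - 1" "2 \<le> v - 1" "v - 1 \<le> N + 5" "odd (v - 1)" "v - 1 - 1 = v - 2"
      using that rho_1_path[of v] by auto
    then show ?thesis unfolding rotation_apply rho_0_path by simp
  qed
  show "rotation 2 = 1"
    using rho_1_path[of 2] by (simp add: rotation_apply rho_0_path)
qed

lemma rotation_up: "2 * k \<le> N + 4 \<Longrightarrow> (rotation ^^ k) 1 = 2 * k + 1"
proof (induction k)
  case (Suc k)
  then have "(rotation ^^ Suc k) 1 = rotation (2 * k + 1)" by simp
  also have "\<dots> = 2 * k + 1 + 2" using Suc.prems by (intro rotation_step(1)) auto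
  finally show ?case by simp
qed simp

text \<open>The offset \<open>(N + 4) div 2 + 1\<close> counts the steps from 1 up to
  \<open>N + 5\<close> and across to \<open>N + 6\<close>.\<close>

lemma rotation_down: "2 * k \<le> N + 4 \<Longrightarrow> (rotation ^^ (k + ((N + 4) div 2 + 1))) 1 = N + 6 - 2 * k"
proof (induction k)
  case 0
  have "(rotation ^^ ((N + 4) div 2)) 1 = N + 5" using rotation_up[of "(N + 4) div 2"] even_N by simp
  then have "(rotation ^^ (Suc ((N + 4) div 2))) 1 = N + 6" using rotation_step(2) by (simp only: funpow.simps o_apply)
  then show ?case by simp
next
  case (Suc k)
  then have "(rotation ^^ (Suc k + ((N + 4) div 2 + 1))) 1 = rotation (N + 6 - 2 * k)" by simp
  also have "\<dots> = N + 6 - 2 * k - 2" using Suc.prems even_N by (intro rotation_step(3)) auto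
  finally show ?case by simp
qed

text \<open>On the ascent the value exceeds 1; on the descent it is even.\<close>

lemma rotation_moves_1:
  assumes "0 < k" "k < N + 6"
  shows "(rotation ^^ k) 1 \<noteq> 1"
proof (cases "2 * k \<le> N + 4")
  case True
  then show ?thesis using rotation_up assms by simp
next
  case False
  define j where "j = k - ((N + 4) div 2 + 1)"
  have "k = j + ((N + 4) div 2 + 1)" "2 * j \<le> N + 4"
    using False assms even_N by (auto simp: j_def)
  moreover have "odd (1 :: nat)" "even (N + 6 - 2 * j)" using even_N by auto
  ultimately show ?thesis using rotation_down[of j] by metis
qed

lemma rotation_order: "rotation ^^ (N + 6) = id"
proof
  fix v
  have full: "(rotation ^^ (N + 6)) 1 = 1"
  proof -
    have "N + 6 = Suc ((N + 4) div 2 + ((N + 4) div 2 + 1))" using even_N by auto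
    moreover have "(rotation ^^ ((N + 4) div 2 + ((N + 4) div 2 + 1))) 1 = 2"
      using rotation_down[of "(N + 4) div 2"] even_N by simp
    ultimately show ?thesis using rotation_step(4) by (simp only: funpow.simps o_apply)
  qed
  \<comment> \<open>Powers of \<open>rotation\<close> commute, so a power that fixes 1 fixes its
    whole orbit, which is the path with \<open>N + 6\<close> included.\<close>
  have orbit: "(rotation ^^ (N + 6)) v = v" if "v = (rotation ^^ k) 1" for k
  proof -
    have "(f ^^ m) ((f ^^ k) w) = (f ^^ k) ((f ^^ m) w)" for f :: "nat \<Rightarrow> nat" and m w
      using funpow_add[of m k f] funpow_add[of k m f] by (metis add.commute o_apply)
    then have "(rotation ^^ (N + 6)) ((rotation ^^ k) 1) = (rotation ^^ k) ((rotation ^^ (N + 6)) 1)" .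
    then show ?thesis unfolding full that .
  qed
  consider "odd v" "v \<le> N + 5" | "even v" "2 \<le> v" "v \<le> N + 6" | "v > N + 6" | "v = 0"
  proof -
    assume *: "odd v \<Longrightarrow> v \<le> N + 5 \<Longrightarrow> thesis" "even v \<Longrightarrow> 2 \<le> v \<Longrightarrow> v \<le> N + 6 \<Longrightarrow> thesis"
      "v > N + 6 \<Longrightarrow> thesis" "v = 0 \<Longrightarrow> thesis"
    have "odd v \<and> v \<le> N + 5 \<or> even v \<and> 2 \<le> v \<and> v \<le> N + 6 \<or> v > N + 6 \<or> v = 0"
      using even_N by presburger
    then show thesis using * by blast
  qed
  then show "(rotation ^^ (N + 6)) v = id v"
  proof cases
    case 1
    then show ?thesis using orbit[of "v div 2"] rotation_up[of "v div 2"] by (auto elim!: oddE)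
  next
    case 2
    then show ?thesis
      using orbit[of "(N + 6 - v) div 2 + ((N + 4) div 2 + 1)"] rotation_down[of "(N + 6 - v) div 2"] even_N by auto
  next
    case 3
    \<comment> \<open>Beyond the path \<open>\<rho> 0\<close> is trivial, so \<open>rotation\<close>
      acts as the involution \<open>\<rho> 1\<close>, and the exponent \<open>N + 6\<close> is
      even.\<close>
    have big: "\<rho> 1 w > N + 6" if "w > N + 6" for w
      using that unfolding thm414_rho_1_apply[OF N] by (simp add: adjacent_swaps_def)
    have "(rotation ^^ 2) v = v"
    proof -
      have "rotation v = \<rho> 1 v" using big[OF 3] by (simp add: rotation_apply rho_0_fix)
      moreover have "rotation (\<rho> 1 v) = \<rho> 1 (\<rho> 1 v)" using big[OF big[OF 3]] by (simp add: rotation_apply rho_0_fix)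
      moreover have "\<rho> 1 (\<rho> 1 v) = v" using fun_cong[OF rho_involution[of 1], of v] by simp
      ultimately show ?thesis by (simp add: numeral_2_eq_2)
    qed
    then have "((rotation ^^ 2) ^^ m) v = v" for m by (induction m) simp_all
    moreover have "rotation ^^ (N + 6) = (rotation ^^ 2) ^^ ((N + 6) div 2)" using even_N by (simp add: funpow_mult)
    ultimately show ?thesis by simp
  next
    case 4
    have "rotation 0 = 0" using rho_1_path[of 0] by (simp add: rotation_apply rho_0_path)
    then have "(rotation ^^ m) 0 = 0" for m by (induction m) simp_all
    then show ?thesis using 4 by simp
  qed
qed

lemma rotation_fixes_1_iff: "(rotation ^^ k) 1 = 1 \<longleftrightarrow> (N + 6) dvd k"
proof -
  have "rotation ^^ k = rotation ^^ (k mod (N + 6) + (N + 6) * (k div (N + 6)))" by simp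
  also have "\<dots> = rotation ^^ (k mod (N + 6))"
    by (subst funpow_add) (simp only: funpow_mult[symmetric] rotation_order id_funpow comp_id)
  finally have "(rotation ^^ k) 1 = (rotation ^^ (k mod (N + 6))) 1" by metis
  moreover have "(rotation ^^ (k mod (N + 6))) 1 = 1 \<longleftrightarrow> k mod (N + 6) = 0"
    using rotation_moves_1[of "k mod (N + 6)"]
    by (metis add_pos_nonneg funpow_0 gr_zeroI le0 mod_less_divisor zero_less_numeral add.commute)
  ultimately show ?thesis by auto
qed

lemma rotation_power_id_iff: "rotation ^^ k = id \<longleftrightarrow> (N + 6) dvd k"
proof
  assume "rotation ^^ k = id"
  then show "(N + 6) dvd k" using rotation_fixes_1_iff[of k] by simp
next
  assume "(N + 6) dvd k"
  then obtain q where "k = (N + 6) * q" by blast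
  then have "rotation ^^ k = (rotation ^^ (N + 6)) ^^ q" by (simp only: funpow_mult)
  then show "rotation ^^ k = id" by (simp only: rotation_order id_funpow)
qed

section \<open>Cosets and intersections in the dihedral group\<close>

lemma gen_image:
  assumes "K \<subseteq> {1..4}" "\<And>k. k \<in> K \<Longrightarrow> point_rho k ` S = S" "x \<in> gen K"
  shows "x ` place 1 ` S = place 1 ` S"
proof (rule generate_sym_group_image[OF assms(3)])
  have lt: "k < 5" if "k \<in> K" for k using assms(1) that by fastforce
  then show "\<rho> ` K \<subseteq> carrier Sym" using rho_carrier by blast
  fix a assume "a \<in> \<rho> ` K"
  then obtain k where k: "k \<in> K" "a = \<rho> k" by blast
  then have "a ` place 1 ` S = place 1 ` point_rho k ` S"
    using assms(1) unfolding image_image k(2) by (intro image_cong refl rho_place) auto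
  then show "a ` place 1 ` S = place 1 ` S" using assms(2) k by simp
qed

text \<open>The dihedral relation, with the inverse of \<open>rotation\<close> written as its power
  \<open>N + 5\<close> to keep exponents natural.\<close>

lemma rotation_rho_1: "rotation ^^ k \<circ> \<rho> 1 = \<rho> 1 \<circ> rotation ^^ (k * (N + 5))"
proof (induction k)
  case (Suc k)
  have inv: "rotation \<circ> (\<rho> 1 \<circ> \<rho> 0) = id"
    using rho_involution[of 0] rho_involution[of 1] unfolding rotation_def
    by (simp add: comp_assoc[symmetric]) (simp add: comp_assoc)
  have "rotation ^^ (N + 5) = rotation ^^ (N + 5) \<circ> (rotation \<circ> (\<rho> 1 \<circ> \<rho> 0))"
    unfolding inv by simp
  also have "\<dots> = rotation ^^ Suc (N + 5) \<circ> (\<rho> 1 \<circ> \<rho> 0)"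
    by (simp only: funpow_Suc_right comp_assoc)
  also have "Suc (N + 5) = N + 6" by simp
  finally have "\<rho> 1 \<circ> rotation ^^ (N + 5) = \<rho> 1 \<circ> (\<rho> 1 \<circ> \<rho> 0)"
    unfolding rotation_order id_comp by (rule arg_cong)
  also have "\<dots> = \<rho> 0"
    using rho_involution[of 1] by (simp add: comp_assoc[symmetric])
  also have "\<dots> = rotation \<circ> \<rho> 1"
    using rho_involution[of 1] by (simp add: rotation_def comp_assoc)
  finally have one: "rotation \<circ> \<rho> 1 = \<rho> 1 \<circ> rotation ^^ (N + 5)" by simp
  have "rotation ^^ Suc k \<circ> \<rho> 1 = rotation \<circ> \<rho> 1 \<circ> rotation ^^ (k * (N + 5))"
    by (simp only: funpow.simps comp_assoc Suc)
  also have "\<dots> = \<rho> 1 \<circ> rotation ^^ (N + 5 + k * (N + 5))"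
    unfolding one by (simp only: funpow_add comp_assoc)
  also have "N + 5 + k * (N + 5) = Suc k * (N + 5)" by simp
  finally show ?case .
qed simp

lemma rotation_permutes: "rotation permutes {1..N + 15}"
  unfolding rotation_def using rho_permutes_even[of 0] rho_permutes_even[of 1] by (simp add: permutes_compose)

text \<open>Takes the place of a coset table, since the size of this group depends on
  \<open>N\<close>. As \<open>\<rho> 0 = rotation \<circ> \<rho> 1\<close>, right multiplication by
  \<open>\<rho> 0\<close> reduces to that by \<open>\<rho> 1\<close> after one more
  rotation.\<close>

lemma gen_01_cover:
  assumes "x \<in> gen {0, 1}"
  shows "\<exists>h\<in>gen {1}. \<exists>k. x = h \<circ> rotation ^^ k"
proof -
  interpret group Sym by (rule group_Sym)
  have cover: "\<exists>h\<in>gen {1}. \<exists>w'\<in>range (\<lambda>k. rotation ^^ k). w \<circ> \<rho> 1 = h \<circ> w'" if "w \<in> range (\<lambda>k. rotation ^^ k)" for w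
    using that rotation_rho_1 by (auto intro!: bexI[of _ "\<rho> 1"] generate.incl)
  have "\<exists>h\<in>gen {1}. \<exists>w\<in>range (\<lambda>k. rotation ^^ k). x = h \<otimes>\<^bsub>Sym\<^esub> w"
  proof (rule generate_involutions_coset_cover[OF _ _ _ _ _ _ assms])
    show "\<rho> ` {0, 1} \<subseteq> carrier Sym" "\<rho> ` {1} \<subseteq> carrier Sym" using rho_carrier by auto
    show "a \<otimes>\<^bsub>Sym\<^esub> a = \<one>\<^bsub>Sym\<^esub>" if "a \<in> \<rho> ` {0, 1}" for a
      using that rho_involution unfolding sym_group_mult sym_group_one by auto
    show "range (\<lambda>k. rotation ^^ k) \<subseteq> carrier Sym"
      using rotation_permutes permutes_funpow sym_group_carrier by blast
    show "\<one>\<^bsub>Sym\<^esub> \<in> range (\<lambda>k. rotation ^^ k)"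
      unfolding sym_group_one by (rule range_eqI[of _ _ 0]) simp
    fix w a assume w: "w \<in> range (\<lambda>k. rotation ^^ k)" and "a \<in> \<rho> ` {0, 1}"
    then consider "a = \<rho> 1" | "a = \<rho> 0" by blast
    then show "\<exists>h\<in>gen {1}. \<exists>w'\<in>range (\<lambda>k. rotation ^^ k). w \<otimes>\<^bsub>Sym\<^esub> a = h \<otimes>\<^bsub>Sym\<^esub> w'"
    proof cases
      case 1
      then show ?thesis using cover[OF w] by (simp only: sym_group_mult)
    next
      case 2
      obtain k where "w = rotation ^^ k" using w by blast
      moreover have "rotation \<circ> \<rho> 1 = \<rho> 0"
        using rho_involution[of 1] by (simp add: rotation_def comp_assoc)
      ultimately have "w \<circ> a = rotation ^^ (Suc k) \<circ> \<rho> 1"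
        unfolding 2 by (simp only: funpow_Suc_right comp_assoc)
      then show ?thesis using cover[OF rangeI, of "Suc k"] by (simp only: sym_group_mult)
    qed
  qed
  then show ?thesis by (auto simp: sym_group_mult)
qed

lemma rho_pair_image: "x \<in> gen {1..4} \<Longrightarrow> x ` {1, 2} = {1, 2}"
proof -
  assume x: "x \<in> gen {1..4}"
  have "k \<in> {1..4} \<Longrightarrow> point_rho k ` {Podd, Peven} = {Podd, Peven}" for k
    by (cases "k = 1") (auto simp: point_rho_def)
  from gen_image[OF _ this x] show ?thesis by (simp add: numeral_2_eq_2)
qed

lemma gen_01_intersection:
  assumes "x \<in> gen {0, 1}" "x \<in> gen {1..4}"
  shows "x \<in> gen {1}"
proof -
  obtain h k where hk: "h \<in> gen {1}" "x = h \<circ> rotation ^^ k" using gen_01_cover assms(1) by blast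
  have "gen {1} \<subseteq> gen {1..4}" by (intro group.mono_generate[OF group_Sym]) auto
  then have h4: "h \<in> gen {1..4}" using hk by blast
  have "\<rho> ` {1..4} \<subseteq> carrier Sym" using rho_carrier by auto
  from subsetD[OF group.generate_incl[OF group_Sym this] h4] have "inj h"
    unfolding sym_group_carrier by (rule permutes_inj)
  have "h ` (rotation ^^ k) ` {1, 2} = h ` {1, 2}"
    using rho_pair_image[OF assms(2)] rho_pair_image[OF h4] unfolding hk(2) image_comp by simp
  then have rot: "(rotation ^^ k) ` {1, 2} = {1, 2}" by (simp only: inj_image_eq_iff[OF \<open>inj h\<close>])
  \<comment> \<open>A power exchanging 1 and 2 would send \<open>rotation 2 = 1\<close> to 2, but
    commuting with \<open>rotation\<close> it must send it to \<open>rotation 1 = 3\<close>.\<close>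
  have "(rotation ^^ k) 1 \<noteq> 2"
  proof
    assume 1: "(rotation ^^ k) 1 = 2"
    have "(rotation ^^ k) 1 \<noteq> (rotation ^^ k) 2"
      using inj_eq[OF permutes_inj[OF permutes_funpow[OF rotation_permutes]], of k 1 2] by simp
    then have 2: "(rotation ^^ k) 2 = 1" using rot 1 by auto
    have "rotation 1 = 3" using rotation_step(1)[of 1] by simp
    moreover have "(rotation ^^ k) (rotation 2) = rotation ((rotation ^^ k) 2)" by (simp add: funpow_swap1)
    ultimately show False using 1 2 rotation_step(4) by simp
  qed
  then have "(rotation ^^ k) 1 = 1" using rot by auto
  then have "rotation ^^ k = id" using rotation_fixes_1_iff rotation_power_id_iff by blast
  then show ?thesis using hk by simp
qed

lemma gen_0_intersection:
  assumes "x \<in> gen {0}" "x \<in> gen {1..4}"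
  shows "x \<in> gen {}"
proof -
  interpret group Sym by (rule group_Sym)
  have "\<exists>h\<in>gen {}. \<exists>w\<in>{id, \<rho> 0}. x = h \<otimes>\<^bsub>Sym\<^esub> w"
  proof (rule generate_involutions_coset_cover[OF _ _ _ _ _ _ assms(1)])
    show "\<rho> ` {0} \<subseteq> carrier Sym" "\<rho> ` {} \<subseteq> carrier Sym" "{id, \<rho> 0} \<subseteq> carrier Sym"
      using rho_carrier by (auto simp: sym_group_carrier permutes_id)
    show "a \<otimes>\<^bsub>Sym\<^esub> a = \<one>\<^bsub>Sym\<^esub>" if "a \<in> \<rho> ` {0}" for a
      using that rho_involution unfolding sym_group_mult sym_group_one by auto
    show "\<one>\<^bsub>Sym\<^esub> \<in> {id, \<rho> 0}" by (simp add: sym_group_one)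
    show "\<exists>h\<in>gen {}. \<exists>w'\<in>{id, \<rho> 0}. w \<otimes>\<^bsub>Sym\<^esub> a = h \<otimes>\<^bsub>Sym\<^esub> w'"
      if "w \<in> {id, \<rho> 0}" "a \<in> \<rho> ` {0}" for w a
      using that rho_involution[of 0] generate.one[of Sym "{}"]
      unfolding sym_group_mult sym_group_one by (auto intro!: bexI[of _ id])
  qed
  then obtain w where "w \<in> {id, \<rho> 0}" "x = w"
    unfolding image_empty generate_empty sym_group_mult sym_group_one by auto
  \<comment> \<open>\<open>\<rho> 0\<close> breaks the pair of 1 and 2, which the group of the other
    generators preserves.\<close>
  moreover have "\<rho> 0 2 \<notin> {1, 2}" by (simp add: rho_0_path)
  ultimately show ?thesis
    using rho_pair_image[OF assms(2)] generate.one[of Sym] unfolding sym_group_one by blast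
qed

text \<open>In the first two cases the cosets enumerated are those of the group without
  \<open>\<rho> 0\<close>, which is independent of \<open>N\<close>; the group with
  \<open>\<rho> 0\<close> enters only through the sets it preserves.\<close>

lemma gen_intersection:
  shows "x \<in> gen {1,2,3,4} \<Longrightarrow> x \<in> gen {0,1,2,3} \<Longrightarrow> x \<in> gen {1,2,3}"
    and "x \<in> gen {1,2,3} \<Longrightarrow> x \<in> gen {0,1,2} \<Longrightarrow> x \<in> gen {1,2}"
    and "x \<in> gen {1} \<Longrightarrow> x \<in> gen {2,3,4} \<Longrightarrow> x \<in> gen {}"
    and "x \<in> gen {1,2} \<Longrightarrow> x \<in> gen {2,3,4} \<Longrightarrow> x \<in> gen {2}"
    and "x \<in> gen {1,2,3} \<Longrightarrow> x \<in> gen {2,3,4} \<Longrightarrow> x \<in> gen {2,3}"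
    and "x \<in> gen {2} \<Longrightarrow> x \<in> gen {3,4} \<Longrightarrow> x \<in> gen {}"
    and "x \<in> gen {2,3} \<Longrightarrow> x \<in> gen {3,4} \<Longrightarrow> x \<in> gen {3}"
    and "x \<in> gen {3} \<Longrightarrow> x \<in> gen {4} \<Longrightarrow> x \<in> gen {}"
  subgoal by (rule coset_table_intersection[OF coset_table_1234_123, unfolded list.set];
      (assumption | auto))
  subgoal by (rule coset_table_intersection[OF coset_table_123_12, unfolded list.set];
      (assumption | auto))
  subgoal by (rule coset_table_intersection[OF coset_table_involution[of 1 "{Podd}"], unfolded list.set];
      (assumption | auto))
  subgoal by (rule coset_table_intersection[OF coset_table_12_2, unfolded list.set];
      (assumption | auto))
  subgoal by (rule coset_table_intersection[OF coset_table_123_23, unfolded list.set];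
      (assumption | auto))
  subgoal by (rule coset_table_intersection[OF coset_table_involution[of 2 "{Pa}"], unfolded list.set];
      (assumption | auto))
  subgoal by (rule coset_table_intersection[OF coset_table_23_3, unfolded list.set];
      (assumption | auto))
  subgoal by (rule coset_table_intersection[OF coset_table_involution[of 3 "{Pb}"], unfolded list.set];
      (assumption | auto))
  done

section \<open>Alternating group\<close>

lemma subgroup_gen: "J \<subseteq> {..<5} \<Longrightarrow> subgroup (gen J) Sym"
  by (rule group.generate_is_subgroup[OF group_Sym]) (use rho_carrier in auto)

lemma word_inverse:
  assumes "set w \<subseteq> {..<5}"
  shows "word w \<circ> word (rev w) = id"
  using assms
proof (induction w)
  case Nil
  show ?case unfolding rev.simps word_simps(1) by simp
next
  case (Cons i w)
  have "word (i # w) \<circ> word (rev (i # w)) = \<rho> i \<circ> (word w \<circ> word (rev w)) \<circ> \<rho> i"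
    by (simp only: rev.simps word_simps comp_assoc comp_id)
  also have "\<dots> = \<rho> i \<circ> \<rho> i"
    using Cons.prems by (subst Cons.IH) (simp_all only: set_simps insert_subset comp_id)
  also have "\<dots> = id" using Cons.prems by (intro rho_involution) simp
  finally show ?case .
qed

text \<open>Fixing \<open>Podd\<close> and \<open>Peven\<close> makes \<open>word w\<close> fix
  every path vertex below \<open>N + 5\<close>, so \<open>three_cycle_eq_conjugate_product\<close>
  applies with \<open>\<rho> 0\<close> as the involution.\<close>

lemma three_cycle_from_word:
  assumes w: "set w \<subseteq> {1..4}" "run w Px = p" "run w Podd = Podd" "run w Peven = Peven"
    and p: "p \<notin> {Px, Podd, Peven}"
  shows "three_cycle (N + 4) (place 1 p) (N + 5) \<in> gen {..<5}"
proof -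
  have w5: "set w \<subseteq> {..<5}" using w(1) by auto
  have perm: "word w permutes {1..N + 15}" using word_carrier[OF w5] by (simp only: sym_group_carrier)
  have small: "word w v = v" if "v < N + 5" for v
  proof (cases "v = 0")
    case True
    then show ?thesis using permutes_not_in[OF perm] by simp
  next
    case False
    then have "v \<in> {1..N + 15}" using that by simp
    then obtain s q where s: "odd s" "s \<le> N + 3" "v = place s q" by (rule ex_place)
    then have "q = Podd \<or> q = Peven" using that by (cases q) auto
    then show ?thesis using s w by (auto simp: word_place)
  qed
  have "three_cycle (N + 4) (place 1 p) (N + 5) \<circ> word w = \<rho> 0 \<circ> word w \<circ> \<rho> 0"
  proof (rule three_cycle_eq_conjugate_product)
    show "inj (word w)" using perm by (rule permutes_inj)
    show "word w v = v" if "v < N + 5" for v using small that .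
    show "word w (N + 5) = place 1 p" using word_place[OF w(1), of 1 Px] w(2) by simp
    show "N + 5 < place 1 p" using p by (cases p) auto
    show "\<rho> 0 \<circ> \<rho> 0 = id" by (rule rho_involution) simp
    show "\<rho> 0 (N + 5) = N + 4" using even_N by (simp add: rho_0_path)
    show "\<rho> 0 v < N + 4" if "v < N + 4" for v
    proof -
      have "v + 1 \<noteq> N + 4" if "even v" using that even_N by presburger
      then show ?thesis using that by (auto simp: rho_0_path)
    qed
    show "\<rho> 0 v = v" if "N + 5 < v" for v using that by (intro rho_0_fix) simp
  qed simp_all
  \<comment> \<open>The reversed word inverts \<open>word w\<close>; cancelling it exhibits the
    3-cycle as a word in the generators.\<close>
  then have "three_cycle (N + 4) (place 1 p) (N + 5) \<circ> (word w \<circ> word (rev w)) = word ([0] @ w @ [0] @ rev w)"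
    by (simp only: word_simps comp_assoc[symmetric] comp_id)
  then have "three_cycle (N + 4) (place 1 p) (N + 5) = word ([0] @ w @ [0] @ rev w)"
    unfolding word_inverse[OF w5] by (simp only: comp_id)
  moreover have "word ([0] @ w @ [0] @ rev w) \<in> gen {..<5}"
    using w5 by (intro word_in_gen) auto
  ultimately show ?thesis by (simp only:)
qed

text \<open>Each word carries \<open>Px\<close> to the wanted point and contains the letter 1
  exactly twice, so it fixes \<open>Podd\<close> and \<open>Peven\<close>.\<close>

lemma three_cycle_in_gen:
  assumes "y \<in> {N + 6..N + 15}"
  shows "three_cycle (N + 4) y (N + 5) \<in> gen {..<5}"
proof -
  have "three_cycle (N + 4) (place 1 p) (N + 5) \<in> gen {..<5}" if "p \<notin> {Px, Podd, Peven}" for p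
  proof (cases p)
    case Pa
    show ?thesis unfolding Pa by (rule three_cycle_from_word[of "[2,1,2,1]"]) simp_all
  next
    case Pb
    show ?thesis unfolding Pb by (rule three_cycle_from_word[of "[1,2,1]"]) simp_all
  next
    case Pc
    show ?thesis unfolding Pc by (rule three_cycle_from_word[of "[1,3,2,1]"]) simp_all
  next
    case Pd
    show ?thesis unfolding Pd by (rule three_cycle_from_word[of "[1,4,3,2,1]"]) simp_all
  next
    case Pe
    show ?thesis unfolding Pe by (rule three_cycle_from_word[of "[2,1,3,2,1]"]) simp_all
  next
    case Pf
    show ?thesis unfolding Pf by (rule three_cycle_from_word[of "[2,1,4,3,2,1]"]) simp_all
  next
    case Pg
    show ?thesis unfolding Pg by (rule three_cycle_from_word[of "[3,2,1,4,3,2,1]"]) simp_all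
  next
    case Ph
    show ?thesis unfolding Ph by (rule three_cycle_from_word[of "[1,2,3,2,1]"]) simp_all
  next
    case Pk
    show ?thesis unfolding Pk by (rule three_cycle_from_word[of "[1,2,4,3,2,1]"]) simp_all
  next
    case Pm
    show ?thesis unfolding Pm by (rule three_cycle_from_word[of "[1,3,2,4,3,2,1]"]) simp_all
  qed (use that in simp_all)
  moreover have "y \<in> {1..N + 15}" using assms by simp
  then obtain s p where p: "odd s" "s \<le> N + 3" "y = place s p" by (rule ex_place)
  moreover have "p \<notin> {Px, Podd, Peven}" "place s p = place 1 p" using p assms by (cases p; auto)+
  ultimately show ?thesis by metis
qed

text \<open>One inclusion is the evenness of the generators. For the other, the 3-cycles through
  \<open>N + 4\<close> and \<open>N + 5\<close> are conjugated into 3-cycles through a fixed pair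
  \<open>b\<close>, \<open>c\<close>, whose third entry is then moved down the path.\<close>

lemma gen_eq_alternating: "gen {..<5} = carrier (alt_group (N + 15))"
proof
  let ?H = "gen {..<5}"
  show "?H \<subseteq> carrier (alt_group (N + 15))"
    by (rule group.generate_subgroup_incl[OF group_Sym _ alt_group_is_subgroup])
      (use rho_permutes_even in \<open>auto simp: alt_group_carrier\<close>)
  have H: "subgroup ?H Sym" by (rule subgroup_gen) simp
  note conj = subgroup_three_cycle_conjugate[OF H]
  \<comment> \<open>\<open>b\<close> and \<open>c\<close> lie beyond the path and are fixed by both
    \<open>\<rho> 0\<close> and \<open>\<rho> 1\<close>, so conjugation by these moves the third
    entry alone.\<close>
  define p q b c where "p = N + 4" and "q = N + 5" and "b = N + 7" and "c = N + 8"
  have star: "three_cycle p y q \<in> ?H" if "y > q" "y \<le> N + 15" for y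
    unfolding p_def q_def using that by (intro three_cycle_in_gen) (simp add: q_def)
  have distinct: "p < q" "q < b" "b < c" "c \<le> N + 15" by (simp_all add: p_def q_def b_def c_def)
  \<comment> \<open>\<open>three_cycle p b q\<close> sends \<open>p\<close> to \<open>b\<close> and
    \<open>q\<close> to \<open>p\<close>, turning \<open>p\<close>, \<open>c\<close>,
    \<open>q\<close> into \<open>b\<close>, \<open>c\<close>, \<open>p\<close>.\<close>
  have "three_cycle b c p \<in> ?H"
    using conj[OF star[of b] star[of c]] distinct by (simp add: three_cycle_apply)
  then have big: "three_cycle b c z \<in> ?H" if "z > q" "z \<le> N + 15" "z \<noteq> b" "z \<noteq> c" for z
    using conj[OF star[of z], of b c p] that distinct by (simp add: three_cycle_apply)
  have small: "three_cycle b c z \<in> ?H" if "z \<le> N + 6" "1 \<le> z" for z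
    using that
  proof (induction rule: inc_induct)
    case base
    show ?case by (rule big) (simp_all add: q_def b_def c_def)
  next
    case (step z)
    \<comment> \<open>The label of the path edge joining \<open>z\<close> and
      \<open>Suc z\<close>.\<close>
    define i :: nat where "i = (if odd z then 1 else 0)"
    have "z \<le> N + 4" if "even z" using that even_N \<open>z < N + 6\<close> by presburger
    have "\<rho> i \<in> ?H" by (rule generate.incl) (simp add: i_def)
    moreover have "\<rho> i (Suc z) = z" "\<rho> i b = b" "\<rho> i c = c"
      using step.hyps step.prems \<open>even z \<Longrightarrow> z \<le> N + 4\<close> rho_1_path[of "Suc z"]
        thm414_rho_1_apply[OF N, of b] thm414_rho_1_apply[OF N, of c]
      by (auto simp: i_def rho_0_path b_def c_def adjacent_swaps_def)
    ultimately show ?case using conj[of "\<rho> i" b c "Suc z"] step.IH by simp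
  qed
  show "carrier (alt_group (N + 15)) \<subseteq> ?H"
  proof (rule alternating_subgroup_of_star[OF H])
    show "b \<noteq> c" using distinct by simp
    show "three_cycle b c z \<in> ?H" if "z \<in> {1..N + 15}" "z \<noteq> b" "z \<noteq> c" for z
      using that big[of z] small[of z] by (cases "z \<le> N + 6") (auto simp: q_def)
  qed
qed

section \<open>String C-group and Schlaefli type\<close>

lemma word_funpow: "word w ^^ k = word (concat (replicate k w))"
  by (induction k) (simp_all only: funpow.simps replicate.simps concat.simps word_simps)

lemma word_pair_order:
  assumes "i \<in> {1..4}" "j \<in> {1..4}" "0 < d"
    and "\<forall>p. run (concat (replicate d [i, j])) p = p"
    and "\<And>k. 0 < k \<Longrightarrow> k < d \<Longrightarrow> \<exists>p. run (concat (replicate k [i, j])) p \<noteq> p"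
  shows "(\<rho> i \<circ> \<rho> j) ^^ k = id \<longleftrightarrow> d dvd k"
proof -
  have word: "\<rho> i \<circ> \<rho> j = word [i, j]" by (simp only: word_simps comp_id)
  have letters: "set (concat (replicate k [i, j])) \<subseteq> {1..4}" for k
    using assms(1,2) by (auto simp: set_replicate_conv_if split: if_splits)
  show ?thesis
    unfolding word
  proof (rule funpow_eq_id_iff_dvd)
    have "word (concat (replicate d [i, j])) = word []"
      by (rule word_eqI) (use assms(4) letters in simp_all)
    then show "word [i, j] ^^ d = id" by (simp only: word_funpow word_simps(1))
    show "word [i, j] ^^ k \<noteq> id" if "0 < k" "k < d" for k
      using assms(5)[OF that] word_eq_idD[OF _ letters] unfolding word_funpow by blast
  qed (rule assms(3))
qed

lemma rho_pair_orders:
  "(\<rho> 1 \<circ> \<rho> 2) ^^ k = id \<longleftrightarrow> 6 dvd k"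
  "(\<rho> 2 \<circ> \<rho> 3) ^^ k = id \<longleftrightarrow> 5 dvd k"
  "(\<rho> 3 \<circ> \<rho> 4) ^^ k = id \<longleftrightarrow> 3 dvd k"
proof -
  show "(\<rho> 1 \<circ> \<rho> 2) ^^ k = id \<longleftrightarrow> 6 dvd k"
  proof (rule word_pair_order)
    fix k :: nat assume "0 < k" "k < 6"
    then have "k \<in> {1, 2, 3, 4, 5}" by auto
    \<comment> \<open>\<open>Px\<close> has period 3 and \<open>Podd\<close> period 2, so together
      they exclude every exponent below 6.\<close>
    then have "run (concat (replicate k [1, 2])) Px \<noteq> Px \<or> run (concat (replicate k [1, 2])) Podd \<noteq> Podd"
      by (auto simp: numeral_eq_Suc point_rho_def)
    then show "\<exists>p. run (concat (replicate k [1, 2])) p \<noteq> p" by blast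
  qed (simp_all add: numeral_eq_Suc all_point point_rho_def)
  show "(\<rho> 2 \<circ> \<rho> 3) ^^ k = id \<longleftrightarrow> 5 dvd k"
  proof (rule word_pair_order)
    fix k :: nat assume "0 < k" "k < 5"
    then have "k \<in> {1, 2, 3, 4}" by auto
    then have "run (concat (replicate k [2, 3])) Pa \<noteq> Pa"
      by (auto simp: numeral_eq_Suc point_rho_def)
    then show "\<exists>p. run (concat (replicate k [2, 3])) p \<noteq> p" by blast
  qed (simp_all add: numeral_eq_Suc all_point point_rho_def)
  show "(\<rho> 3 \<circ> \<rho> 4) ^^ k = id \<longleftrightarrow> 3 dvd k"
  proof (rule word_pair_order)
    fix k :: nat assume "0 < k" "k < 3"
    then have "k \<in> {1, 2}" by auto
    then have "run (concat (replicate k [3, 4])) Pb \<noteq> Pb"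
      by (auto simp: numeral_eq_Suc point_rho_def)
    then show "\<exists>p. run (concat (replicate k [3, 4])) p \<noteq> p" by blast
  qed (simp_all add: numeral_eq_Suc all_point point_rho_def)
qed

text \<open>For \<open>j = 0\<close> the supports are disjoint: \<open>\<rho> 0\<close> moves only
  points up to \<open>N + 5\<close>, \<open>\<rho> k\<close> only points from \<open>N + 6\<close>
  on. The other three pairs are compared on points.\<close>

lemma rho_commute:
  assumes "j < 5" "k < 5" "j + 2 \<le> k"
  shows "\<rho> j \<circ> \<rho> k = \<rho> k \<circ> \<rho> j"
proof (cases "j = 0")
  case True
  have "k = 2 \<or> k = 3 \<or> k = 4" using assms by linarith
  then have low: "\<rho> k v = v" if "v \<le> N + 5" for v
    using that by (auto simp: thm414_rho_2 thm414_rho_3 thm414_rho_4 transpose_def)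
  have bij: "inj (\<rho> k)" using rho_permutes_even[OF assms(2)] permutes_inj by blast
  have "\<rho> 0 (\<rho> k v) = \<rho> k (\<rho> 0 v)" for v
  proof (cases "v \<le> N + 5")
    case True
    moreover have "v \<noteq> N + 5" if "even v" using that even_N by auto
    ultimately have "\<rho> 0 v \<le> N + 5" by (auto simp: rho_0_path)
    then show ?thesis using True low by simp
  next
    case False
    then have "\<rho> k v \<ge> N + 6" using low[of "\<rho> k v"] injD[OF bij, of "\<rho> k v" v] by (cases "\<rho> k v \<le> N + 5") auto
    then show ?thesis using False by (simp add: rho_0_fix)
  qed
  then show ?thesis using True by (simp add: fun_eq_iff)
next
  case False
  have "(j, k) \<in> {(1, 3), (1, 4), (2, 4)}" using assms False by auto
  then have "\<forall>p. run [j, k] p = run [k, j] p" by (auto simp: all_point)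
  then have "word [j, k] = word [k, j]" using assms False by (intro word_eqI) auto
  then show ?thesis by (simp only: word_simps comp_id)
qed

lemma intersection_property_Sym: "intersection_property Sym \<rho> 5"
proof (rule group.intersection_property_from_intervals[OF group_Sym])
  show "\<rho> j \<in> carrier Sym" if "j < 5" for j using that by (rule rho_carrier)
  show "\<rho> j \<otimes>\<^bsub>Sym\<^esub> \<rho> k = \<rho> k \<otimes>\<^bsub>Sym\<^esub> \<rho> j" if "j < 5" "k < 5" "j + 2 \<le> k" for j k
    unfolding sym_group_mult using that by (rule rho_commute)
  fix i p x
  assume ip: "i \<le> p" "p + 1 < 5" and x: "x \<in> gen {i..p}" "x \<in> gen {i + 1..<5}"
  have sets: "{Suc 0..4} = {1, 2, 3, 4}" "{0..Suc 0} = {0, 1}" "{0..2} = {0, 1, 2 :: nat}"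
    "{0..3} = {0, 1, 2, 3 :: nat}" "{Suc 0..<5} = {1, 2, 3, 4}" "{2..<5} = {2, 3, 4 :: nat}"
    "{3..<5} = {3, 4 :: nat}" "{4..<5} = {4 :: nat}" "{Suc 0..2} = {1, 2}" "{Suc 0..3} = {1, 2, 3}"
    "{2..3} = {2, 3 :: nat}" "{Suc (Suc 0)..<5} = {2, 3, 4}" "{Suc (Suc 0)..3} = {2, 3}" "{Suc (Suc 0)..2} = {2}"
    by auto
  have mono: "gen J \<subseteq> gen K" if "J \<subseteq> K" for J K
    using that by (intro group.mono_generate[OF group_Sym]) blast
  have "i = 0 \<and> p = 0 \<or> i = 0 \<and> p = 1 \<or> i = 0 \<and> p = 2 \<or> i = 0 \<and> p = 3
    \<or> i = 1 \<and> p = 1 \<or> i = 1 \<and> p = 2 \<or> i = 1 \<and> p = 3 \<or> i = 2 \<and> p = 2 \<or> i = 2 \<and> p = 3 \<or> i = 3 \<and> p = 3"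
    using ip by presburger
  then consider "i = 0" "p = 0" | "i = 0" "p = 1" | "i = 0" "p = 2" | "i = 0" "p = 3"
    | "i = 1" "p = 1" | "i = 1" "p = 2" | "i = 1" "p = 3" | "i = 2" "p = 2" | "i = 2" "p = 3" | "i = 3" "p = 3"
    by blast
  then show "x \<in> gen {i + 1..p}"
  proof cases
    case 1
    then show ?thesis using x gen_0_intersection[of x] by (simp add: sets)
  next
    case 2
    then show ?thesis using x gen_01_intersection[of x] by (simp add: sets)
  next
    case 3
    \<comment> \<open>Enlarging to \<open>gen {0, 1, 2, 3}\<close> first puts \<open>x\<close> into
      \<open>gen {1, 2, 3}\<close>, after which the table for 1, 2, 3 over 1, 2 applies.\<close>
    then have "x \<in> gen {0, 1, 2}" "x \<in> gen {1, 2, 3, 4}" using x by (simp_all add: sets)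
    moreover from this have "x \<in> gen {0, 1, 2, 3}" using mono[of "{0, 1, 2}" "{0, 1, 2, 3}"] by auto
    ultimately show ?thesis using gen_intersection(1,2)[of x] 3 by (simp add: sets)
  next
    case 4
    then show ?thesis using x gen_intersection(1)[of x] by (simp add: sets)
  next
    case 5
    then show ?thesis using x gen_intersection(3)[of x] by (simp add: sets)
  next
    case 6
    then show ?thesis using x gen_intersection(4)[of x] by (simp add: sets)
  next
    case 7
    then show ?thesis using x gen_intersection(5)[of x] by (simp add: sets)
  next
    case 8
    then show ?thesis using x gen_intersection(6)[of x] by (simp add: sets)
  next
    case 9
    then show ?thesis using x gen_intersection(7)[of x] by (simp add: sets)
  next
    case 10
    then show ?thesis using x gen_intersection(8)[of x] by (simp add: sets)
  qed
qed

text \<open>An equality of records: both sides are \<open>Sym\<close> with its carrier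
  replaced.\<close>

lemma thm414_group_eq_alternating: "thm414_group (N + 15) = alt_group (N + 15)"
  using gen_eq_alternating by (simp add: thm414_group_def alt_group_def)

text \<open>Generation inside a subgroup agrees with generation in the whole group; this carries the
  intersection property over from \<open>Sym\<close>.\<close>

lemma generate_alternating:
  assumes "J \<subseteq> {..<5}"
  shows "generate (alt_group (N + 15)) (\<rho> ` J) = gen J"
proof -
  have "\<rho> ` J \<subseteq> carrier (alt_group (N + 15))"
    using assms rho_permutes_even by (auto simp: alt_group_carrier)
  from group.generate_consistent[OF group_Sym this alt_group_is_subgroup] show ?thesis
    by (simp add: alt_group_def)
qed

lemma rho_neq_id: "i < 5 \<Longrightarrow> \<rho> i \<noteq> id"
proof (cases "i = 0")
  case True
  have "\<rho> 0 2 \<noteq> 2" by (simp add: rho_0_path)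
  then show ?thesis using True by auto
next
  case False
  assume "i < 5"
  with False have i: "i \<in> {1..4}" by simp
  \<comment> \<open>The vertex \<open>m\<close> is an end of edges with every label from 1 to
    4.\<close>
  moreover have "point_rho i Pm \<noteq> Pm" using i by (auto simp: point_rho_def)
  ultimately have "\<rho> i (place 1 Pm) \<noteq> place 1 Pm" using rho_place[of i 1 Pm] place_1_inject[of "point_rho i Pm" Pm] by simp
  then show ?thesis by auto
qed

lemma string_C_group_alternating: "string_C_group (alt_group (N + 15)) \<rho> 5"
proof -
  have "sggi (alt_group (N + 15)) \<rho> 5"
    unfolding sggi_def
  proof (intro conjI allI impI)
    show "group (alt_group (N + 15))" by (rule alt_group_is_group)
    show "\<rho> i \<in> carrier (alt_group (N + 15))" if "i < 5" for i
      using that rho_permutes_even by (simp add: alt_group_carrier)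
    show "\<rho> i \<noteq> \<one>\<^bsub>alt_group (N + 15)\<^esub>" if "i < 5" for i
      unfolding alt_group_one using that by (rule rho_neq_id)
    show "\<rho> i \<otimes>\<^bsub>alt_group (N + 15)\<^esub> \<rho> i = \<one>\<^bsub>alt_group (N + 15)\<^esub>" if "i < 5" for i
      unfolding alt_group_mult alt_group_one using that by (rule rho_involution)
    show "generate (alt_group (N + 15)) (\<rho> ` {..<5}) = carrier (alt_group (N + 15))"
      using generate_alternating gen_eq_alternating by simp
    fix i j :: nat assume ij: "i < 5" "j < 5" "i + 2 \<le> j \<or> j + 2 \<le> i"
    then have "\<rho> i \<circ> \<rho> j = \<rho> j \<circ> \<rho> i" using rho_commute by metis
    then have "(\<rho> i \<circ> \<rho> j) \<circ> (\<rho> i \<circ> \<rho> j) = (\<rho> i \<circ> \<rho> i) \<circ> (\<rho> j \<circ> \<rho> j)"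
      by (metis comp_assoc)
    then show "(\<rho> i \<otimes>\<^bsub>alt_group (N + 15)\<^esub> \<rho> j) \<otimes>\<^bsub>alt_group (N + 15)\<^esub>
      (\<rho> i \<otimes>\<^bsub>alt_group (N + 15)\<^esub> \<rho> j) = \<one>\<^bsub>alt_group (N + 15)\<^esub>"
      unfolding alt_group_mult alt_group_one rho_involution[OF ij(1)] rho_involution[OF ij(2)]
      by (simp only: comp_id)
  qed
  moreover have "intersection_property (alt_group (N + 15)) \<rho> 5"
    using intersection_property_Sym unfolding intersection_property_def
    by (metis (no_types, lifting) generate_alternating inf.coboundedI1)
  ultimately show ?thesis by (simp add: string_C_group_def)
qed

lemma schlafli_type_alternating: "schlafli_type (alt_group (N + 15)) \<rho> 5 [N + 6, 6, 5, 3]"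
proof -
  let ?A = "alt_group (N + 15)"
  have ord: "group.ord ?A (\<rho> i \<otimes>\<^bsub>?A\<^esub> \<rho> j) = d"
    if "i < 5" "j < 5" "\<And>k. (\<rho> i \<circ> \<rho> j) ^^ k = id \<longleftrightarrow> d dvd k" for i j d
  proof -
    interpret group ?A by (rule alt_group_is_group)
    have "\<rho> i \<in> carrier ?A" "\<rho> j \<in> carrier ?A"
      using that rho_permutes_even by (simp_all add: alt_group_carrier)
    then have "\<rho> i \<otimes>\<^bsub>?A\<^esub> \<rho> j \<in> carrier ?A" by (rule m_closed)
    moreover have "(\<rho> i \<otimes>\<^bsub>?A\<^esub> \<rho> j) [^]\<^bsub>?A\<^esub> k = \<one>\<^bsub>?A\<^esub> \<longleftrightarrow> d dvd k" for k :: nat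
      unfolding pow_eq_funpow[OF alt_group_mult alt_group_one] unfolding alt_group_mult alt_group_one by (rule that(3))
    ultimately show ?thesis using ord_unique by blast
  qed
  have orders: "group.ord ?A (\<rho> 0 \<otimes>\<^bsub>?A\<^esub> \<rho> 1) = N + 6" "group.ord ?A (\<rho> 1 \<otimes>\<^bsub>?A\<^esub> \<rho> 2) = 6"
    "group.ord ?A (\<rho> 2 \<otimes>\<^bsub>?A\<^esub> \<rho> 3) = 5" "group.ord ?A (\<rho> 3 \<otimes>\<^bsub>?A\<^esub> \<rho> 4) = 3"
    by (rule ord; use rotation_power_id_iff[unfolded rotation_def] rho_pair_orders in simp)+
  show ?thesis
    unfolding schlafli_type_def
  proof (intro conjI allI impI)
    fix i :: nat assume "1 \<le> i \<and> i \<le> 5 - 1"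
    then have "i = 1 \<or> i = 2 \<or> i = 3 \<or> i = 4" by auto
    then show "[N + 6, 6, 5, 3] ! (i - 1) = group.ord ?A (\<rho> (i - 1) \<otimes>\<^bsub>?A\<^esub> \<rho> i)"
      using orders by (elim disjE) simp_all
  qed simp
qed

end

theorem theorem4p14:
  fixes n :: nat
  assumes "n \<ge> 15" and "n mod 4 = 3"
  shows "thm414_group n \<cong> alt_group n
    \<and> string_C_group (thm414_group n) (thm414_rho n) 5
    \<and> schlafli_type (thm414_group n) (thm414_rho n) 5 [n - 9, 6, 5, 3]"
proof -
  define N where "N = n - 15"
  have n: "n = N + 15" using assms by (simp add: N_def)
  have "4 dvd N" using assms unfolding n by presburger
  then interpret thm414 N by unfold_locales
  have "n - 9 = N + 6" by (simp add: n)
  \<comment> \<open>The two groups are equal, so the isomorphism is reflexivity.\<close>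
  then show ?thesis
    using string_C_group_alternating schlafli_type_alternating
    unfolding n[symmetric] thm414_group_eq_alternating[folded n] by (simp add: iso_refl)
qed

end
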